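(* Let $T$ be a weighted tree on $n\ge 2$ vertices, where each edge weight is a positive definite matrix of order $s$. Let $D$ be the distance matrix of $T$ and let $L$ denote the Laplacian matrix of $T$ in which each edge weight matrix is replaced by its inverse. Let $\mu_1\ge\mu_2\ge\cdots\ge\mu_s>0>\mu_{s+1}\ge\cdots\ge\mu_{ns}$ be the eigenvalues of $D$ and $\lambda_1\ge\lambda_2\ge\cdots\ge\lambda_{ns-s}>\lambda_{ns-s+1}=\cdots=\lambda_{ns}=0$ be the eigenvalues of $L$. Then $$\mu_{s+i}\le-\frac{2}{\lambda_i}\le\mu_i\qquad\text{for } i=1,2,\dots,ns-s.$$
   Context: Matrices have real entries; positive definite matrices are symmetric. Eigenvalues are listed with multiplicity. With vertex set $\{1,\dots,n\}$, the distance matrix $D$ of $T$ is the $ns\times ns$ block matrix with $s\times s$ blocks $D_{i,j}$, where $D_{i,j}$ is the sum of the weight matrices of the edges on the unique path from $i$ to $j$ in $T$ (so $D_{i,i}=0$). If $W_e$ is the weight of edge $e$, $L$ is the $ns\times ns$ block matrix whose $(i,i)$ block is the sum of $W_e^{-1}$ over all edges $e$ incident with $i$, and whose $(i,j)$ block for $i\ne j$ is $-W_e^{-1}$ if $e=\{i,j\}$ is an edge and the zero matrix otherwise. It is known that $D$ has exactly $s$ positive and $(n-1)s$ negative eigenvalues, and $L$ is positive semidefinite of rank $(n-1)s$, so the eigenvalues can be listed as in the statement. *)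

theory Defs
  imports
    "Graph_Theory.Graph_Theory"
    "Jordan_Normal_Form.Char_Poly"
    "Jordan_Normal_Form.Gauss_Jordan_Elimination"
begin

section \<open>Trees\<close>

text \<open>
  A finite simple graph is a \<^locale>\<open>pair_graph\<close>: a finite, loop-free digraph whose arc relation
  is symmetric. The undirected edge joining \<open>u\<close> and \<open>v\<close> appears there as the two arcs
  \<open>(u, v)\<close> and \<open>(v, u)\<close>.
\<close>

definition undirected_edges :: "'a pair_pre_digraph \<Rightarrow> 'a set set" where
  "undirected_edges T = (\<lambda>(u, v). {u, v}) ` parcs T"

text \<open>
  The constant \<open>tree\<close> of the library is not usable for symmetric digraphs: it forbids every directed
  cycle, including the closed walk \<open>u, v, u\<close> that runs back and forth along one edge. In a
  loop-free symmetric digraph the cycles of the underlying undirected graph are exactly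
  the directed cycles of length at least three. Being connected includes having a vertex.
\<close>

definition undirected_tree :: "'a pair_pre_digraph \<Rightarrow> bool" where
  "undirected_tree T \<longleftrightarrow>
     pair_graph T \<and> Digraph_Component.connected (with_proj T) \<and>
     \<not> (\<exists>p. pre_digraph.cycle (with_proj T) p \<and> 3 \<le> length p)"

text \<open>
  The undirected edges on the path from \<open>i\<close> to \<open>j\<close>; the definite description
  is meaningful because paths between two vertices of a tree exist and are unique.
  For \<open>i = j\<close> the path is empty.
\<close>

definition path_edges :: "'a pair_pre_digraph \<Rightarrow> 'a \<Rightarrow> 'a \<Rightarrow> 'a set set" where
  "path_edges T i j =
     (\<lambda>(u, v). {u, v}) ` set (THE p. pre_digraph.apath (with_proj T) i p j)"

section \<open>Matrices\<close>

definition pos_def_mat :: "nat \<Rightarrow> real mat \<Rightarrow> bool" where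
  "pos_def_mat s A \<longleftrightarrow>
     A \<in> carrier_mat s s \<and> transpose_mat A = A \<and>
     (\<forall>v \<in> carrier_vec s. v \<noteq> 0\<^sub>v s \<longrightarrow> 0 < v \<bullet> (A *\<^sub>v v))"

text \<open>
  The library function \<^const>\<open>mat_inverse\<close> returns \<^const>\<open>None\<close> on singular matrices; below, it is
  only applied to positive definite ones.
\<close>

definition inv_mat :: "real mat \<Rightarrow> real mat" where
  "inv_mat A = the (mat_inverse A)"

text \<open>
  Sums of \<open>s \<times> s\<close> matrices are written entrywise, as the matrix type, which comprises
  all dimensions, has no zero and hence no \<^const>\<open>sum\<close>.
\<close>

definition mat_sum :: "nat \<Rightarrow> ('e \<Rightarrow> real mat) \<Rightarrow> 'e set \<Rightarrow> real mat" where
  "mat_sum s F E = mat s s (\<lambda>(k, l). \<Sum>e\<in>E. F e $$ (k, l))"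

text \<open>The matrix made of \<open>n \<times> n\<close> blocks \<open>B i j\<close> of size \<open>s \<times> s\<close>, all indices starting at 0.\<close>

definition block_mat :: "nat \<Rightarrow> nat \<Rightarrow> (nat \<Rightarrow> nat \<Rightarrow> real mat) \<Rightarrow> real mat" where
  "block_mat n s B =
     mat (n * s) (n * s) (\<lambda>(a, b). B (a div s) (b div s) $$ (a mod s, b mod s))"

text \<open>
  Distance and Laplacian matrix of a graph with vertices \<open>0, \<dots>, n - 1\<close> whose edge
  \<open>{u, v}\<close> carries the weight \<open>W {u, v}\<close>.
\<close>

definition distance_mat ::
  "nat \<Rightarrow> nat \<Rightarrow> nat pair_pre_digraph \<Rightarrow> (nat set \<Rightarrow> real mat) \<Rightarrow> real mat" where
  "distance_mat n s T W = block_mat n s (\<lambda>i j. mat_sum s W (path_edges T i j))"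

definition laplacian_mat ::
  "nat \<Rightarrow> nat \<Rightarrow> nat pair_pre_digraph \<Rightarrow> (nat set \<Rightarrow> real mat) \<Rightarrow> real mat" where
  "laplacian_mat n s T W = block_mat n s (\<lambda>i j.
     if i = j then mat_sum s (\<lambda>e. inv_mat (W e)) {e \<in> undirected_edges T. i \<in> e}
     else if {i, j} \<in> undirected_edges T then - inv_mat (W {i, j})
     else 0\<^sub>m s s)"

text \<open>
  \<open>\<mu> 1 \<ge> \<mu> 2 \<ge> \<dots> \<ge> \<mu> N\<close> are the eigenvalues of \<open>A\<close> with multiplicity. Algebraic multiplicity
  is used; it agrees with geometric multiplicity for symmetric matrices.
\<close>

definition eigenvalues_decreasing :: "nat \<Rightarrow> real mat \<Rightarrow> (nat \<Rightarrow> real) \<Rightarrow> bool" where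
  "eigenvalues_decreasing N A \<mu> \<longleftrightarrow>
     A \<in> carrier_mat N N \<and>
     char_poly A = (\<Prod>i\<in>{1..N}. [:- \<mu> i, 1:]) \<and>
     (\<forall>i j. 1 \<le> i \<and> i \<le> j \<and> j \<le> N \<longrightarrow> \<mu> j \<le> \<mu> i)"

end

theory Submission
  imports Defs
begin

text \<open>
  Deleting an edge \<open>e\<close> of the tree cuts it in two; \<open>e\<close> lies on the path from \<open>i\<close> to \<open>j\<close> iff the cut
  separates \<open>i\<close> from \<open>j\<close>. With the indicator \<open>a\<^sub>e\<close> of one side, the quadratic form of \<open>D\<close> on vectors
  whose blocks sum to zero is therefore \<open>-2\<close> times the sum over \<open>e\<close> of \<open>W\<^sub>e\<close> evaluated at the
  \<open>a\<^sub>e\<close>-weighted block sum. For a vector \<open>L y\<close> this block sum is the flow \<open>W\<^sub>e\<^sup>-\<^sup>1 (y\<^sub>p - y\<^sub>q)\<close> through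
  \<open>e = {p, q}\<close>, which gives \<open>L D L = -2 L\<close>. So on the span of the eigenvectors of \<open>L\<close> for nonzero
  eigenvalues \<open>\<lambda>\<^sub>i\<close>, a subspace of codimension \<open>s\<close>, the form of \<open>D\<close> is diagonal with entries
  \<open>-2 / \<lambda>\<^sub>i\<close>, and the theorem is Cauchy interlacing for this compression of \<open>D\<close>.
\<close>

section \<open>Spectral theorem for real symmetric matrices\<close>

text \<open>Vectors are functions of which only the values below \<open>N\<close> matter, so sums
  over indices can be rearranged without dimension side conditions.\<close>

definition quad_form :: "nat \<Rightarrow> real mat \<Rightarrow> (nat \<Rightarrow> real) \<Rightarrow> real" where
  "quad_form N A x = (\<Sum>a<N. \<Sum>b<N. x a * A $$ (a, b) * x b)"

text \<open>The vectors are numbered from 1 like the eigenvalues, their coordinates from 0 like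
  matrix entries. The second clause is the completeness relation, from which Parseval's identity and
  the spectral decomposition are read off.\<close>

definition orthonormal_eigenbasis ::
  "nat \<Rightarrow> real mat \<Rightarrow> (nat \<Rightarrow> real) \<Rightarrow> (nat \<Rightarrow> nat \<Rightarrow> real) \<Rightarrow> bool" where
  "orthonormal_eigenbasis N A \<mu> u \<longleftrightarrow>
     (\<forall>i\<in>{1..N}. \<forall>j\<in>{1..N}. (\<Sum>a<N. u i a * u j a) = of_bool (i = j)) \<and>
     (\<forall>a<N. \<forall>b<N. (\<Sum>i=1..N. u i a * u i b) = of_bool (a = b)) \<and>
     (\<forall>i\<in>{1..N}. \<forall>a<N. (\<Sum>b<N. A $$ (a, b) * u i b) = \<mu> i * u i a)"

lemma dot_self_nonneg: "0 \<le> v \<bullet> v" for v :: "real vec"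
  by (auto simp: scalar_prod_def intro!: sum_nonneg)

lemma dot_self_eq_0_iff:
  fixes v :: "real vec"
  assumes "v \<in> carrier_vec n"
  shows "v \<bullet> v = 0 \<longleftrightarrow> v = 0\<^sub>v n"
proof
  assume "v \<bullet> v = 0"
  then have "\<forall>i\<in>{0..<n}. v $ i * v $ i = 0"
    using assms by (subst sum_nonneg_eq_0_iff[symmetric]) (auto simp: scalar_prod_def)
  then show "v = 0\<^sub>v n" using assms by (intro eq_vecI) auto
qed simp

text \<open>Symmetry carries the zeros of the first column over to the first row. This is the
  deflation step of the diagonalization.\<close>

lemma four_block_mat_col_1:
  fixes M :: "real mat"
  assumes M: "M \<in> carrier_mat (Suc m) (Suc m)" and sym: "transpose_mat M = M"
    and col: "M *\<^sub>v unit_vec (Suc m) 0 = e \<cdot>\<^sub>v unit_vec (Suc m) 0"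
  obtains A where "A \<in> carrier_mat m m" "transpose_mat A = A"
    "M = four_block_mat (mat 1 1 (\<lambda>_. e)) (0\<^sub>m 1 m) (0\<^sub>m m 1) A"
proof -
  define A where "A = mat m m (\<lambda>(i, j). M $$ (Suc i, Suc j))"
  have symM: "M $$ (i, j) = M $$ (j, i)" if "i < Suc m" "j < Suc m" for i j
    using sym M that by (metis carrier_matD index_transpose_mat(1))
  have col0: "M $$ (i, 0) = (if i = 0 then e else 0)" if "i < Suc m" for i
  proof -
    have "(M *\<^sub>v unit_vec (Suc m) 0) $ i = M $$ (i, 0)"
      using that M by (simp add: scalar_prod_right_unit[of _ "Suc m"])
    then show ?thesis unfolding col using that by (auto split: if_splits)
  qed
  have "M = four_block_mat (mat 1 1 (\<lambda>_. e)) (0\<^sub>m 1 m) (0\<^sub>m m 1) A"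
  proof (rule eq_matI)
    fix i j
    assume "i < dim_row (four_block_mat (mat 1 1 (\<lambda>_. e)) (0\<^sub>m 1 m) (0\<^sub>m m 1) A)"
      "j < dim_col (four_block_mat (mat 1 1 (\<lambda>_. e)) (0\<^sub>m 1 m) (0\<^sub>m m 1) A)"
    then have "i < Suc m" "j < Suc m" by (auto simp: A_def)
    then show "M $$ (i, j) = four_block_mat (mat 1 1 (\<lambda>_. e)) (0\<^sub>m 1 m) (0\<^sub>m m 1) A $$ (i, j)"
      using col0[of i] col0[of j] symM[of i j] by (auto simp: A_def)
  qed (use M in \<open>auto simp: A_def\<close>)
  moreover have "transpose_mat A = A"
    by (rule eq_matI) (auto simp: A_def symM)
  moreover have "A \<in> carrier_mat m m" by (simp add: A_def)
  ultimately show thesis by (intro that[of A])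
qed

lemma householder:
  fixes v :: "real vec"
  assumes v: "v \<in> carrier_vec n" and norm: "v \<bullet> v = 1" and n: "0 < n"
  obtains H where "H \<in> carrier_mat n n" "transpose_mat H = H" "H * H = 1\<^sub>m n"
    "H *\<^sub>v unit_vec n 0 = v"
proof -
  \<comment> \<open>Reflection that exchanges the first unit vector and \<open>v\<close>; for equal vectors \<open>c = 2 / 0 = 0\<close>
    and \<open>H\<close> is the identity.\<close>
  define w where "w = unit_vec n 0 - v"
  define c where "c = 2 / (w \<bullet> w)"
  define H where "H = mat n n (\<lambda>(i, j). (if i = j then 1 else 0) - c * w $ i * w $ j)"
  have w: "w \<in> carrier_vec n" using v by (simp add: w_def)
  have w0: "w $ 0 = 1 - v $ 0" and wi: "w $ i = (if i = 0 then 1 else 0) - v $ i" if "i < n" for i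
    using n v that by (auto simp: w_def)
  have ww: "w \<bullet> w = 2 * w $ 0"
  proof -
    have "w \<bullet> w = (\<Sum>i\<in>{0..<n}. (if i = 0 then 1 - 2 * v $ 0 else 0) + v $ i * v $ i)"
      using w by (auto simp: scalar_prod_def wi algebra_simps intro!: sum.cong)
    also have "\<dots> = (1 - 2 * v $ 0) + v \<bullet> v"
      using n v by (simp add: sum.distrib scalar_prod_def sum.delta)
    finally show ?thesis using norm n by (simp add: w0)
  qed
  have "c * c * (w \<bullet> w) = 2 * c" by (simp add: c_def)
  \<comment> \<open>If \<open>w\<close> is nonzero, \<open>ww\<close> gives
    \<open>c * w $ 0 = 1\<close>. Hence the first column of \<open>H\<close> is the first unit
    vector minus \<open>w\<close>, which is \<open>v\<close>.\<close>
  have cw: "c * w $ 0 * w $ i = w $ i" if "i < n" for i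
  proof (cases "w \<bullet> w = 0")
    case True
    then have "w = 0\<^sub>v n" using dot_self_eq_0_iff[OF w] by simp
    then show ?thesis using that by simp
  next
    case False
    then show ?thesis using ww by (simp add: c_def)
  qed
  have sq: "H * H = 1\<^sub>m n"
  proof (rule eq_matI)
    fix i j assume "i < dim_row (1\<^sub>m n :: real mat)" "j < dim_col (1\<^sub>m n :: real mat)"
    then have ij: "i < n" "j < n" by auto
    have "(H * H) $$ (i, j) = (\<Sum>k\<in>{0..<n}.
        ((if i = k then 1 else 0) - c * w $ i * w $ k) * ((if k = j then 1 else 0) - c * w $ k * w $ j))"
      using ij by (simp add: H_def scalar_prod_def)
    also have "\<dots> = (\<Sum>k\<in>{0..<n}. (if k = i then (if i = j then 1 else 0) - c * w $ i * w $ j else 0)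
        - (if k = j then c * w $ i * w $ j else 0) + c * c * w $ i * w $ j * (w $ k * w $ k))"
      by (intro sum.cong) (auto simp: algebra_simps)
    also have "\<dots> = (if i = j then 1 else 0) - c * w $ i * w $ j - c * w $ i * w $ j
        + c * c * w $ i * w $ j * (w \<bullet> w)"
      using ij w by (simp add: sum.distrib sum_subtractf sum.delta scalar_prod_def
          flip: sum_distrib_left)
    also have "c * c * w $ i * w $ j * (w \<bullet> w) = 2 * c * w $ i * w $ j"
      using \<open>c * c * (w \<bullet> w) = 2 * c\<close> by (metis (no_types, opaque_lifting) mult.assoc mult.commute)
    finally show "(H * H) $$ (i, j) = 1\<^sub>m n $$ (i, j)" using ij by simp
  qed (auto simp: H_def)
  show thesis
  proof (rule that[of H])
    show "H \<in> carrier_mat n n" by (simp add: H_def)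
    show "transpose_mat H = H" by (rule eq_matI) (auto simp: H_def)
    show "H * H = 1\<^sub>m n" by (fact sq)
    show "H *\<^sub>v unit_vec n 0 = v"
    proof (rule eq_vecI)
      fix i assume "i < dim_vec v"
      then have i: "i < n" using v by simp
      have "(H *\<^sub>v unit_vec n 0) $ i = H $$ (i, 0)"
        using i n by (simp add: H_def scalar_prod_right_unit[of _ n])
      also have "\<dots> = (if i = 0 then 1 else 0) - c * w $ 0 * w $ i"
        using i n by (simp add: H_def)
      also have "\<dots> = v $ i" unfolding cw[OF i] using wi[OF i] by simp
      finally show "(H *\<^sub>v unit_vec n 0) $ i = v $ i" .
    qed (use v in \<open>auto simp: H_def\<close>)
  qed
qed

lemma unit_eigenvector:
  fixes A :: "real mat"
  assumes A: "A \<in> carrier_mat n n" and root: "poly (char_poly A) e = 0"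
  obtains v where "v \<in> carrier_vec n" "v \<bullet> v = 1" "A *\<^sub>v v = e \<cdot>\<^sub>v v"
proof -
  obtain u where u: "u \<in> carrier_vec n" "u \<noteq> 0\<^sub>v n" "A *\<^sub>v u = e \<cdot>\<^sub>v u"
    using root A unfolding eigenvalue_root_char_poly[OF A, symmetric] eigenvalue_def
      eigenvector_def by auto
  define r where "r = 1 / sqrt (u \<bullet> u)"
  have "u \<bullet> u > 0" using u dot_self_nonneg[of u] dot_self_eq_0_iff[of u n] by fastforce
  show thesis
  proof (rule that[of "r \<cdot>\<^sub>v u"])
    show "r \<cdot>\<^sub>v u \<in> carrier_vec n" using u by simp
    have "(r \<cdot>\<^sub>v u) \<bullet> (r \<cdot>\<^sub>v u) = r * r * (u \<bullet> u)"
      using u by (simp add: scalar_prod_smult_distrib[of _ n] smult_scalar_prod_distrib[of _ n])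
    then show "(r \<cdot>\<^sub>v u) \<bullet> (r \<cdot>\<^sub>v u) = 1" using \<open>u \<bullet> u > 0\<close> by (simp add: r_def)
    show "A *\<^sub>v (r \<cdot>\<^sub>v u) = e \<cdot>\<^sub>v (r \<cdot>\<^sub>v u)"
      using u A by (simp add: mult_mat_vec[of _ n n] smult_smult_assoc mult.commute)
  qed
qed

text \<open>Induction on the list of roots. The head \<open>e\<close> has a unit eigenvector;
  conjugation by the reflection that moves the first unit vector there splits off the block
  \<open>e\<close>, and the induction hypothesis diagonalizes the rest.\<close>

lemma orthogonal_diagonalization:
  fixes A :: "real mat"
  assumes "A \<in> carrier_mat n n" "transpose_mat A = A"
    and "char_poly A = (\<Prod>e\<leftarrow>es. [:- e, 1:])"
  shows "\<exists>P \<in> carrier_mat n n. transpose_mat P * P = 1\<^sub>m n \<and> A * P = P * mat_diag n ((!) es)"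
  using assms
proof (induction es arbitrary: n A)
  case Nil
  then have "n = 0" using degree_monic_char_poly[of A n] by simp
  then show ?case using Nil by (intro bexI[of _ "1\<^sub>m 0"]) (auto intro!: eq_matI simp: mat_diag_def)
next
  case (Cons e es)
  note A = Cons.prems(1)
  have "degree (\<Prod>e\<leftarrow>e#es. [:- e, 1:]) = Suc (length es)"
    by (subst degree_linear_factors) simp
  then have "n = Suc (length es)"
    using degree_monic_char_poly[OF A] unfolding Cons.prems(3) by (simp only:)
  then obtain m where n: "n = Suc m" by blast
  obtain v where v: "v \<in> carrier_vec n" "v \<bullet> v = 1" "A *\<^sub>v v = e \<cdot>\<^sub>v v"
    using unit_eigenvector[OF A, of e] Cons.prems(3) by auto
  obtain H where H: "H \<in> carrier_mat n n" "transpose_mat H = H" "H * H = 1\<^sub>m n"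
    "H *\<^sub>v unit_vec n 0 = v"
    using householder[OF v(1,2)] n by auto
  define M where "M = H * A * H"
  have M: "M \<in> carrier_mat n n" using A H by (simp add: M_def)
  have Mt: "transpose_mat M = M"
    using A H Cons.prems(2) by (simp add: M_def transpose_mult[of _ n n _ n] assoc_mult_mat[of _ n n _ n _ n])
  have e0: "unit_vec n 0 \<in> carrier_vec n" by simp
  have "H *\<^sub>v v = unit_vec n 0"
    using H assoc_mult_mat_vec[OF H(1) H(1) e0] by simp
  then have "M *\<^sub>v unit_vec n 0 = e \<cdot>\<^sub>v unit_vec n 0"
    using A H v by (simp add: M_def assoc_mult_mat_vec[of _ n n _ n] mult_mat_vec[of _ n n])
  with M Mt obtain B where B: "B \<in> carrier_mat m m" "transpose_mat B = B"
    "M = four_block_mat (mat 1 1 (\<lambda>_. e)) (0\<^sub>m 1 m) (0\<^sub>m m 1) B"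
    unfolding n by (rule four_block_mat_col_1)
  have HM: "H * M = A * H"
  proof -
    have "H * M = H * (H * (A * H))"
      using A H by (simp add: M_def assoc_mult_mat[of _ n n _ n _ n])
    also have "\<dots> = H * H * (A * H)"
      using A H by (intro assoc_mult_mat[symmetric, of _ n n _ n _ n]) auto
    also have "\<dots> = A * H" unfolding H(3) using A H by simp
    finally show ?thesis .
  qed
  \<comment> \<open>\<open>H\<close> is its own inverse, so conjugation by it preserves the
    characteristic polynomial. Cancelling the factor of the block \<open>e\<close> leaves for
    \<open>B\<close> the factorization over \<open>es\<close> that the induction hypothesis asks
    for.\<close>
  have "similar_mat A M"
    unfolding similar_mat_def similar_mat_wit_def Let_def
    using A H M HM by (intro exI[of _ H]) (auto simp: assoc_mult_mat[of _ n n _ n _ n])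
  then have "char_poly A = char_poly M" by (rule char_poly_similar)
  also have "\<dots> = char_poly (mat 1 1 (\<lambda>_. e)) * char_poly B"
    unfolding B(3) using B(1) by (intro char_poly_four_block_zeros_col) auto
  also have "char_poly (mat 1 1 (\<lambda>_. e)) = [:- e, 1:]"
    by (subst char_poly_upper_triangular[of _ 1]) (auto simp: diag_mat_def)
  finally have "[:- e, 1:] * char_poly B = [:- e, 1:] * (\<Prod>e\<leftarrow>es. [:- e, 1:])"
    using Cons.prems(3) by simp
  then have "char_poly B = (\<Prod>e\<leftarrow>es. [:- e, 1:])" by (subst (asm) mult_left_cancel) auto
  from Cons.IH[OF B(1,2) this] obtain Q where Q: "Q \<in> carrier_mat m m"
    "transpose_mat Q * Q = 1\<^sub>m m" "B * Q = Q * mat_diag m ((!) es)" by auto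
  \<comment> \<open>\<open>R\<close> fixes the first coordinate and lets \<open>Q\<close> act on the
    others; \<open>H * R\<close> then diagonalizes \<open>A\<close>.\<close>
  define R where "R = four_block_mat (1\<^sub>m 1) (0\<^sub>m 1 m) (0\<^sub>m m 1) Q"
  have R: "R \<in> carrier_mat n n" using Q four_block_carrier_mat[of "1\<^sub>m 1" 1 1 Q m m]
    by (simp add: R_def n)
  have Rt: "transpose_mat R = four_block_mat (1\<^sub>m 1) (0\<^sub>m 1 m) (0\<^sub>m m 1) (transpose_mat Q)"
    unfolding R_def using Q by (subst transpose_four_block_mat) auto
  have RR: "transpose_mat R * R = 1\<^sub>m n"
    unfolding Rt unfolding R_def using Q
    by (subst mult_four_block_mat[of _ 1 1 _ m _ m _ _ 1 _ m]) (auto simp: n)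
  have D: "mat_diag n ((!) (e # es)) =
      four_block_mat (mat 1 1 (\<lambda>_. e)) (0\<^sub>m 1 m) (0\<^sub>m m 1) (mat_diag m ((!) es))"
    by (rule eq_matI) (auto simp: n mat_diag_def nth_Cons')
  have MR: "M * R = R * mat_diag n ((!) (e # es))"
    unfolding D B(3) R_def using Q B(1)
    by (subst (1 2) mult_four_block_mat[of _ 1 1 _ m _ m _ _ 1 _ m])
      (auto simp: left_mult_zero_mat[OF mat_diag_dim])
  show ?case
  proof (intro bexI conjI)
    show "H * R \<in> carrier_mat n n" using H R by simp
    have "H * (H * R) = R"
      using assoc_mult_mat[OF H(1) H(1) R] H(3) R by (metis left_mult_one_mat)
    moreover have "transpose_mat (H * R) * (H * R) = transpose_mat R * (H * (H * R))"
      using H R by (simp add: transpose_mult[of _ n n _ n] assoc_mult_mat[of _ n n _ n _ n])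
    ultimately show "transpose_mat (H * R) * (H * R) = 1\<^sub>m n" using RR by simp
    have "A * (H * R) = H * M * R"
      using A H R HM by (simp add: assoc_mult_mat[of _ n n _ n _ n])
    also have "\<dots> = H * R * mat_diag n ((!) (e # es))"
      using A H R M MR by (simp add: assoc_mult_mat[of _ n n _ n _ n])
    finally show "A * (H * R) = H * R * mat_diag n ((!) (e # es))" .
  qed
qed

lemma orthonormal_eigenbasis_exists:
  fixes A :: "real mat"
  assumes ev: "eigenvalues_decreasing N A \<mu>" and sym: "transpose_mat A = A"
  obtains u where "orthonormal_eigenbasis N A \<mu> u"
proof -
  define es where "es = map \<mu> [1..<Suc N]"
  have A: "A \<in> carrier_mat N N" using ev by (simp add: eigenvalues_decreasing_def)
  have "(\<Prod>e\<leftarrow>es. [:- e, 1:]) = (\<Prod>i\<in>{1..N}. [:- \<mu> i, 1:])"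
    unfolding es_def map_map comp_def
    by (subst prod.distinct_set_conv_list[symmetric])
       (simp_all only: distinct_upt set_upt atLeastLessThanSuc_atLeastAtMost)
  with ev have "char_poly A = (\<Prod>e\<leftarrow>es. [:- e, 1:])" by (simp add: eigenvalues_decreasing_def)
  from orthogonal_diagonalization[OF A sym this] obtain P where P: "P \<in> carrier_mat N N"
    "transpose_mat P * P = 1\<^sub>m N" "A * P = P * mat_diag N ((!) es)" by auto
  \<comment> \<open>A left inverse of a square matrix is a right inverse; orthonormal columns thus
    yield the completeness relation.\<close>
  have PP: "P * transpose_mat P = 1\<^sub>m N"
    using P mat_mult_left_right_inverse[of "transpose_mat P" N P] by simp
  define u where "u i a = P $$ (a, i - 1)" for i a
  show thesis
  proof (rule that[of u], unfold orthonormal_eigenbasis_def, intro conjI ballI allI impI)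
    fix i j assume ij: "i \<in> {1..N}" "j \<in> {1..N}"
    then have "(transpose_mat P * P) $$ (i - 1, j - 1) = (\<Sum>a<N. u i a * u j a)"
      using P(1) by (auto simp: scalar_prod_def u_def lessThan_atLeast0 intro!: sum.cong)
    moreover have "1\<^sub>m N $$ (i - 1, j - 1) = (of_bool (i = j) :: real)"
      using ij by (subst index_one_mat) auto
    ultimately show "(\<Sum>a<N. u i a * u j a) = of_bool (i = j)" unfolding P(2) by simp
  next
    fix a b assume ab: "a < N" "b < N"
    then have "(P * transpose_mat P) $$ (a, b) = (\<Sum>i<N. u (Suc i) a * u (Suc i) b)"
      using P(1) by (auto simp: scalar_prod_def u_def lessThan_atLeast0 intro!: sum.cong)
    also have "\<dots> = (\<Sum>i=1..N. u i a * u i b)"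
      by (rule sum.reindex_bij_witness[of _ "\<lambda>i. i - 1" Suc]) auto
    finally show "(\<Sum>i=1..N. u i a * u i b) = of_bool (a = b)"
      using ab unfolding PP by auto
  next
    fix i a assume ia: "i \<in> {1..N}" "a < N"
    then have "(A * P) $$ (a, i - 1) = (\<Sum>b<N. A $$ (a, b) * u i b)"
      using P(1) A by (auto simp: scalar_prod_def u_def lessThan_atLeast0 intro!: sum.cong)
    moreover have "(P * mat_diag N ((!) es)) $$ (a, i - 1) = \<mu> i * u i a"
      using ia P(1) by (subst mat_diag_mult_right) (auto simp: es_def u_def simp del: upt_Suc)
    ultimately show "(\<Sum>b<N. A $$ (a, b) * u i b) = \<mu> i * u i a" using P(3) by simp
  qed
qed

section \<open>Interlacing by dimension counting\<close>

text \<open>Gaussian elimination by induction on the equations: an equation with a nonzero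
  coefficient at \<open>j0\<close> is solved for that unknown, which costs one equation and one
  unknown.\<close>

lemma underdetermined_system:
  fixes f :: "'k \<Rightarrow> 'j \<Rightarrow> real"
  assumes "finite K" "finite J" "card K < card J"
  shows "\<exists>c. (\<exists>j\<in>J. c j \<noteq> 0) \<and> (\<forall>k\<in>K. (\<Sum>j\<in>J. f k j * c j) = 0)"
  using assms
proof (induction K arbitrary: J f rule: finite_induct)
  case empty
  then have "J \<noteq> {}" by auto
  then show ?case by (intro exI[of _ "\<lambda>_. 1"]) auto
next
  case (insert k K)
  show ?case
  proof (cases "\<forall>j\<in>J. f k j = 0")
    case True
    have "card K < card J" using insert by simp
    from insert.IH[OF insert.prems(1) this] obtain c where
      "\<exists>j\<in>J. c j \<noteq> 0" "\<forall>k\<in>K. (\<Sum>j\<in>J. f k j * c j) = 0" by blast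
    then show ?thesis using True by (intro exI[of _ c]) auto
  next
    case False
    then obtain j0 where j0: "j0 \<in> J" "f k j0 \<noteq> 0" by auto
    define J' where "J' = J - {j0}"
    have J': "finite J'" "J = insert j0 J'" "j0 \<notin> J'" using insert j0 by (auto simp: J'_def)
    have "card K < card J'" using insert J' by simp
    \<comment> \<open>These are the coefficients after equation \<open>k\<close> has been used to
      eliminate the unknown \<open>j0\<close>; \<open>c'\<close> below restores its value.\<close>
    from insert.IH[OF J'(1) this, of "\<lambda>l j. f l j - f l j0 * f k j / f k j0"]
    obtain c where c: "\<exists>j\<in>J'. c j \<noteq> 0"
      "\<And>l. l \<in> K \<Longrightarrow> (\<Sum>j\<in>J'. (f l j - f l j0 * f k j / f k j0) * c j) = 0" by blast
    define c' where "c' = c(j0 := - (\<Sum>j\<in>J'. f k j * c j) / f k j0)"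
    have split: "(\<Sum>j\<in>J. f l j * c' j) = f l j0 * c' j0 + (\<Sum>j\<in>J'. f l j * c j)" for l
      using J' by (auto simp: c'_def intro!: sum.cong)
    have "(\<Sum>j\<in>J. f l j * c' j) = 0" if "l \<in> insert k K" for l
    proof (cases "l = k")
      case True
      then show ?thesis using j0 by (subst split) (simp add: c'_def)
    next
      case False
      then have "(\<Sum>j\<in>J'. (f l j - f l j0 * f k j / f k j0) * c j) = 0" using that c by simp
      moreover have "(\<Sum>j\<in>J'. (f l j - f l j0 * f k j / f k j0) * c j)
          = (\<Sum>j\<in>J'. f l j * c j) - f l j0 / f k j0 * (\<Sum>j\<in>J'. f k j * c j)"
        unfolding sum_distrib_left sum_subtractf[symmetric]
        by (intro sum.cong) (auto simp: algebra_simps)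
      ultimately show ?thesis by (subst split) (simp add: c'_def)
    qed
    moreover have "\<exists>j\<in>J. c' j \<noteq> 0" using c(1) J' by (auto simp: c'_def)
    ultimately show ?thesis by blast
  qed
qed

lemma sum_of_bool_mult:
  fixes f :: "'a \<Rightarrow> real"
  assumes "finite S" "b \<in> S"
  shows "(\<Sum>a\<in>S. f a * of_bool (a = b)) = f b"
proof -
  have "(\<Sum>a\<in>S. f a * of_bool (a = b)) = (\<Sum>a\<in>S. if a = b then f a else 0)"
    by (intro sum.cong) auto
  then show ?thesis using assms by simp
qed

section \<open>Coordinates with respect to an orthonormal eigenbasis\<close>

context
  fixes N :: nat and A :: "real mat" and \<mu> :: "nat \<Rightarrow> real" and u :: "nat \<Rightarrow> nat \<Rightarrow> real"
  assumes basis: "orthonormal_eigenbasis N A \<mu> u"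
begin

lemma parseval: "(\<Sum>a<N. x a * x a) = (\<Sum>i=1..N. (\<Sum>a<N. u i a * x a)\<^sup>2)"
proof -
  have "(\<Sum>i=1..N. (\<Sum>a<N. u i a * x a)\<^sup>2) =
      (\<Sum>i=1..N. \<Sum>a<N. \<Sum>b<N. x a * x b * (u i a * u i b))"
    by (simp add: power2_eq_square sum_product mult_ac)
  also have "\<dots> = (\<Sum>a<N. \<Sum>b<N. \<Sum>i=1..N. x a * x b * (u i a * u i b))"
    by (simp only: sum.swap[of _ _ "{1..N}"])
  also have "\<dots> = (\<Sum>a<N. \<Sum>b<N. x a * x b * of_bool (b = a))"
    unfolding sum_distrib_left[symmetric]
    using basis by (intro sum.cong refl arg_cong2[where f = "(*)"])
      (auto simp: orthonormal_eigenbasis_def)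
  also have "\<dots> = (\<Sum>a<N. x a * x a)"
    by (intro sum.cong refl sum_of_bool_mult) auto
  finally show ?thesis ..
qed

lemma quad_form_eq: "quad_form N A x = (\<Sum>i=1..N. \<mu> i * (\<Sum>a<N. u i a * x a)\<^sup>2)"
proof -
  \<comment> \<open>Spectral decomposition of \<open>A\<close>: after \<open>\<mu> i * u i\<close>
    is replaced by the image of \<open>u i\<close> under \<open>A\<close>, completeness collapses
    the sum over \<open>i\<close>.\<close>
  have spec: "(\<Sum>i=1..N. \<mu> i * u i a * u i b) = A $$ (a, b)" if "a < N" "b < N" for a b
  proof -
    have "(\<Sum>i=1..N. \<mu> i * u i a * u i b) = (\<Sum>i=1..N. (\<Sum>c<N. A $$ (a, c) * u i c) * u i b)"
      using basis that by (intro sum.cong) (auto simp: orthonormal_eigenbasis_def)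
    also have "\<dots> = (\<Sum>c<N. A $$ (a, c) * (\<Sum>i=1..N. u i c * u i b))"
      unfolding sum_distrib_left sum_distrib_right by (subst sum.swap) (simp add: mult_ac)
    also have "\<dots> = (\<Sum>c<N. A $$ (a, c) * of_bool (c = b))"
      using basis that by (intro sum.cong) (auto simp: orthonormal_eigenbasis_def)
    also have "\<dots> = A $$ (a, b)" using that by (intro sum_of_bool_mult) auto
    finally show ?thesis .
  qed
  have "(\<Sum>i=1..N. \<mu> i * (\<Sum>a<N. u i a * x a)\<^sup>2) =
      (\<Sum>i=1..N. \<Sum>a<N. \<Sum>b<N. x a * (\<mu> i * u i a * u i b) * x b)"
    by (simp add: power2_eq_square sum_product sum_distrib_left mult_ac)
  also have "\<dots> = (\<Sum>a<N. \<Sum>b<N. \<Sum>i=1..N. x a * (\<mu> i * u i a * u i b) * x b)"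
    by (simp only: sum.swap[of _ _ "{1..N}"])
  also have "\<dots> = quad_form N A x"
    unfolding sum_distrib_left[symmetric] sum_distrib_right[symmetric] quad_form_def
    by (intro sum.cong refl) (use spec in simp)
  finally show ?thesis ..
qed

lemma basis_coordinate:
  assumes "J \<subseteq> {1..N}" "i \<in> {1..N}"
  shows "(\<Sum>a<N. u i a * (\<Sum>j\<in>J. c j * u j a)) = (if i \<in> J then c i else 0)"
proof -
  have fin: "finite J" using assms finite_subset by blast
  have "(\<Sum>a<N. u i a * (\<Sum>j\<in>J. c j * u j a)) = (\<Sum>j\<in>J. c j * (\<Sum>a<N. u i a * u j a))"
    unfolding sum_distrib_left by (subst sum.swap) (simp add: mult_ac)
  also have "\<dots> = (\<Sum>j\<in>J. c j * of_bool (i = j))"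
    using basis assms by (intro sum.cong) (auto simp: orthonormal_eigenbasis_def)
  also have "\<dots> = (\<Sum>j\<in>J. if i = j then c j else 0)" by (intro sum.cong) auto
  also have "\<dots> = (if i \<in> J then c i else 0)" using fin by simp
  finally show ?thesis .
qed

lemma basis_norm:
  assumes "J \<subseteq> {1..N}"
  shows "(\<Sum>a<N. (\<Sum>j\<in>J. c j * u j a) * (\<Sum>j\<in>J. c j * u j a)) = (\<Sum>j\<in>J. (c j)\<^sup>2)"
proof -
  have "(\<Sum>a<N. (\<Sum>j\<in>J. c j * u j a) * (\<Sum>j\<in>J. c j * u j a))
      = (\<Sum>i=1..N. if i \<in> J then (c i)\<^sup>2 else 0)"
    unfolding parseval using assms by (intro sum.cong) (auto simp: basis_coordinate)
  also have "\<dots> = (\<Sum>j\<in>J. (c j)\<^sup>2)"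
    using assms by (simp add: sum.inter_restrict[symmetric] Int_absorb1)
  finally show ?thesis .
qed

lemma basis_quad_form:
  assumes "J \<subseteq> {1..N}"
  shows "quad_form N A (\<lambda>a. \<Sum>j\<in>J. c j * u j a) = (\<Sum>j\<in>J. \<mu> j * (c j)\<^sup>2)"
proof -
  have "quad_form N A (\<lambda>a. \<Sum>j\<in>J. c j * u j a) = (\<Sum>i=1..N. if i \<in> J then \<mu> i * (c i)\<^sup>2 else 0)"
    unfolding quad_form_eq using assms by (intro sum.cong) (auto simp: basis_coordinate)
  also have "\<dots> = (\<Sum>j\<in>J. \<mu> j * (c j)\<^sup>2)"
    using assms by (simp add: sum.inter_restrict[symmetric] Int_absorb1)
  finally show ?thesis .
qed

lemma mat_apply_basis:
  assumes "J \<subseteq> {1..N}" "a < N"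
  shows "(\<Sum>b<N. A $$ (a, b) * (\<Sum>j\<in>J. c j * u j b)) = (\<Sum>j\<in>J. \<mu> j * c j * u j a)"
proof -
  have "(\<Sum>b<N. A $$ (a, b) * (\<Sum>j\<in>J. c j * u j b)) = (\<Sum>j\<in>J. c j * (\<Sum>b<N. A $$ (a, b) * u j b))"
    unfolding sum_distrib_left by (subst sum.swap) (simp add: mult_ac)
  also have "\<dots> = (\<Sum>j\<in>J. \<mu> j * c j * u j a)"
    using basis assms by (intro sum.cong) (auto simp: orthonormal_eigenbasis_def)
  finally show ?thesis .
qed

end

lemma quad_form_cong: "(\<And>a. a < N \<Longrightarrow> x a = y a) \<Longrightarrow> quad_form N A x = quad_form N A y"
  by (simp add: quad_form_def)

lemma sum_positive_if_nonzero:
  fixes c :: "'a \<Rightarrow> real"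
  assumes "finite J" "\<exists>j\<in>J. c j \<noteq> 0"
  shows "0 < (\<Sum>j\<in>J. (c j)\<^sup>2)"
  using assms by (meson sum_pos2 zero_le_power2 zero_less_power2)

section \<open>Positive eigenvalues and interlacing\<close>

text \<open>If \<open>lam i\<close> were not positive, the form would be nonpositive on the span of
  \<open>u i, ..., u N\<close>. Its dimension \<open>N - i + 1\<close> exceeds \<open>s\<close>, so
  it contains a nonzero vector whose first \<open>s\<close> coordinates vanish, against
  \<open>pos\<close>. For the Laplacian, \<open>pos\<close> is definiteness after grounding one
  vertex.\<close>

lemma eigenvalue_positive:
  assumes u: "orthonormal_eigenbasis N B lam u"
    and dec: "\<And>i j. 1 \<le> i \<Longrightarrow> i \<le> j \<Longrightarrow> j \<le> N \<Longrightarrow> lam j \<le> lam i"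
    and pos: "\<And>x. quad_form N B x \<le> 0 \<Longrightarrow> (\<And>k. k < s \<Longrightarrow> x k = 0) \<Longrightarrow> (\<And>a. a < N \<Longrightarrow> x a = 0)"
    and i: "1 \<le> i" "i \<le> N - s"
  shows "0 < lam i"
proof (rule ccontr)
  assume "\<not> 0 < lam i"
  define J where "J = {i..N}"
  have J: "finite J" "J \<subseteq> {1..N}" using i by (auto simp: J_def)
  have "card {..<s} < card J" using i by (auto simp: J_def)
  from underdetermined_system[OF _ J(1) this, of "\<lambda>k j. u j k"] obtain c where
    c: "\<exists>j\<in>J. c j \<noteq> 0" "\<And>k. k < s \<Longrightarrow> (\<Sum>j\<in>J. u j k * c j) = 0" by auto
  define x where "x = (\<lambda>a. \<Sum>j\<in>J. c j * u j a)"
  have "quad_form N B x = (\<Sum>j\<in>J. lam j * (c j)\<^sup>2)"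
    unfolding x_def by (rule basis_quad_form[OF u J(2)])
  also have "\<dots> \<le> 0"
  proof (intro sum_nonpos mult_nonpos_nonneg)
    fix j assume "j \<in> J"
    then show "lam j \<le> 0" using dec[of i j] i \<open>\<not> 0 < lam i\<close> by (auto simp: J_def)
  qed auto
  finally have "x a = 0" if "a < N" for a
    using pos[of x a] c(2) that by (simp add: x_def mult.commute)
  then have "(\<Sum>j\<in>J. (c j)\<^sup>2) = 0"
    unfolding basis_norm[OF u J(2), symmetric] by (simp add: x_def)
  then show False using sum_positive_if_nonzero[OF J(1) c(1)] by simp
qed

text \<open>
  As \<open>card K < card J\<close>, there is a nonzero \<open>x = \<Sum>j\<in>J. c j u j\<close> orthogonal to every \<open>w k\<close> with \<open>k \<in> K\<close>;
  then \<open>p\<close> and \<open>q\<close> are its squared coordinates in the two bases. The value of the form of \<open>A\<close> at \<open>x\<close>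
  comes from \<open>inv\<close>, as \<open>x\<close> is the image under \<open>B\<close> of \<open>\<Sum>j\<in>J. (c j / lam j) u j\<close>.
\<close>

lemma weights_of_dimension_count:
  assumes w: "orthonormal_eigenbasis N A mu w" and u: "orthonormal_eigenbasis N B lam u"
    and inv: "\<And>y. quad_form N A (\<lambda>a. \<Sum>b<N. B $$ (a, b) * y b) = - 2 * quad_form N B y"
    and J: "J \<subseteq> {1..N}" "\<And>j. j \<in> J \<Longrightarrow> lam j \<noteq> 0"
    and K: "K \<subseteq> {1..N}" "card K < card J"
  obtains p q :: "nat \<Rightarrow> real" where "\<And>j. 0 \<le> p j" "\<And>l. 0 \<le> q l"
    "0 < (\<Sum>j\<in>J. p j)" "(\<Sum>l\<in>{1..N}-K. q l) = (\<Sum>j\<in>J. p j)"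
    "(\<Sum>l\<in>{1..N}-K. mu l * q l) = (\<Sum>j\<in>J. - 2 / lam j * p j)"
proof -
  have fin: "finite J" "finite K" using J K finite_subset by blast+
  from underdetermined_system[OF fin(2,1) K(2), of "\<lambda>k j. \<Sum>a<N. w k a * u j a"] obtain c where
    c: "\<exists>j\<in>J. c j \<noteq> 0" "\<And>k. k \<in> K \<Longrightarrow> (\<Sum>j\<in>J. (\<Sum>a<N. w k a * u j a) * c j) = 0" by blast
  define x where "x = (\<lambda>a. \<Sum>j\<in>J. c j * u j a)"
  define q where "q = (\<lambda>l. (\<Sum>a<N. w l a * x a)\<^sup>2)"
  have q0: "q l = 0" if "l \<in> K" for l
  proof -
    have "(\<Sum>a<N. w l a * x a) = (\<Sum>j\<in>J. (\<Sum>a<N. w l a * u j a) * c j)"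
      unfolding x_def sum_distrib_left sum_distrib_right by (subst sum.swap) (simp add: mult_ac)
    then show ?thesis using c(2)[OF that] by (simp add: q_def)
  qed
  have "(\<Sum>l\<in>{1..N}-K. q l) = (\<Sum>l=1..N. q l)"
    using q0 by (intro sum.mono_neutral_left) auto
  also have "\<dots> = (\<Sum>a<N. x a * x a)" unfolding q_def by (rule parseval[OF w, symmetric])
  also have "\<dots> = (\<Sum>j\<in>J. (c j)\<^sup>2)" unfolding x_def by (rule basis_norm[OF u J(1)])
  finally have norm: "(\<Sum>l\<in>{1..N}-K. q l) = (\<Sum>j\<in>J. (c j)\<^sup>2)" .
  define y where "y = (\<lambda>a. \<Sum>j\<in>J. (c j / lam j) * u j a)"
  have "(\<Sum>l\<in>{1..N}-K. mu l * q l) = (\<Sum>l=1..N. mu l * q l)"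
    using q0 by (intro sum.mono_neutral_left) auto
  also have "\<dots> = quad_form N A x" unfolding q_def by (rule quad_form_eq[OF w, symmetric])
  also have "\<dots> = quad_form N A (\<lambda>a. \<Sum>b<N. B $$ (a, b) * y b)"
  proof (rule quad_form_cong)
    fix a assume "a < N"
    then show "x a = (\<Sum>b<N. B $$ (a, b) * y b)"
      unfolding y_def mat_apply_basis[OF u J(1) \<open>a < N\<close>] x_def
      using J(2) by (intro sum.cong) auto
  qed
  also have "\<dots> = - 2 * (\<Sum>j\<in>J. lam j * (c j / lam j)\<^sup>2)"
    unfolding inv y_def basis_quad_form[OF u J(1)] ..
  also have "\<dots> = (\<Sum>j\<in>J. - 2 / lam j * (c j)\<^sup>2)"
    unfolding sum_distrib_left using J(2) by (intro sum.cong) (auto simp: power2_eq_square)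
  finally have "(\<Sum>l\<in>{1..N}-K. mu l * q l) = (\<Sum>j\<in>J. - 2 / lam j * (c j)\<^sup>2)" .
  with norm show thesis
    using sum_positive_if_nonzero[OF fin(1) c(1)]
    by (intro that[of "\<lambda>j. (c j)\<^sup>2" q]) (auto simp: q_def)
qed

text \<open>Each bound compares two weighted sums with the same total weight, one of values
  \<open>mu l\<close>, one of values \<open>- 2 / lam j\<close>. The choices satisfy
  \<open>card J = card K + 1\<close>, and monotonicity bounds both sums by the value at the extreme
  index.\<close>

lemma interlacing:
  assumes w: "orthonormal_eigenbasis N A mu w" and u: "orthonormal_eigenbasis N B lam u"
    and mu_dec: "\<And>i j. 1 \<le> i \<Longrightarrow> i \<le> j \<Longrightarrow> j \<le> N \<Longrightarrow> mu j \<le> mu i"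
    and lam_dec: "\<And>i j. 1 \<le> i \<Longrightarrow> i \<le> j \<Longrightarrow> j \<le> N \<Longrightarrow> lam j \<le> lam i"
    and inv: "\<And>y. quad_form N A (\<lambda>a. \<Sum>b<N. B $$ (a, b) * y b) = - 2 * quad_form N B y"
    and pos: "\<And>i. i \<in> {1..N - s} \<Longrightarrow> 0 < lam i"
    and i: "i \<in> {1..N - s}"
  shows "mu (s + i) \<le> - 2 / lam i" "- 2 / lam i \<le> mu i"
proof -
  have mono: "- 2 / lam j \<le> - 2 / lam k" if "j \<in> {1..N - s}" "k \<in> {1..N - s}" "k \<le> j" for j k
    using pos[OF that(1)] pos[OF that(2)] lam_dec[of k j] that by (auto simp: field_simps)
  \<comment> \<open>Upper bound: outside \<open>K\<close> every \<open>mu l\<close> is at least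
    \<open>mu (s + i)\<close>, and on \<open>J\<close> every \<open>- 2 / lam j\<close> is at most
    \<open>- 2 / lam i\<close>. For \<open>i = N - s\<close> the set \<open>K\<close> is
    empty.\<close>
  define J where "J = {i..N - s}"
  define K where "K = {Suc (s + i)..N}"
  have "J \<subseteq> {1..N}" "K \<subseteq> {1..N}" "card K < card J" "\<And>j. j \<in> J \<Longrightarrow> lam j \<noteq> 0"
    using i pos by (auto simp: J_def K_def less_imp_neq[symmetric])
  from weights_of_dimension_count[OF w u inv this(1,4,2,3)] obtain p q :: "nat \<Rightarrow> real" where
    pq: "\<And>j. 0 \<le> p j" "\<And>l. 0 \<le> q l" "0 < (\<Sum>j\<in>J. p j)" "(\<Sum>l\<in>{1..N}-K. q l) = (\<Sum>j\<in>J. p j)"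
    "(\<Sum>l\<in>{1..N}-K. mu l * q l) = (\<Sum>j\<in>J. - 2 / lam j * p j)" by blast
  have "mu (s + i) * (\<Sum>j\<in>J. p j) = (\<Sum>l\<in>{1..N}-K. mu (s + i) * q l)"
    by (simp add: sum_distrib_left flip: pq(4))
  also have "\<dots> \<le> (\<Sum>l\<in>{1..N}-K. mu l * q l)"
    using i by (intro sum_mono mult_right_mono mu_dec pq) (auto simp: K_def)
  also have "\<dots> \<le> (\<Sum>j\<in>J. - 2 / lam i * p j)"
    unfolding pq(5) using i by (intro sum_mono mult_right_mono mono pq) (auto simp: J_def)
  also have "\<dots> = - 2 / lam i * (\<Sum>j\<in>J. p j)" by (simp add: sum_distrib_left)
  finally show "mu (s + i) \<le> - 2 / lam i" using pq(3) by (simp only: mult_le_cancel_right_pos)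
  \<comment> \<open>Lower bound: now every \<open>- 2 / lam j\<close> on \<open>J\<close> is at
    least \<open>- 2 / lam i\<close>, and outside \<open>K\<close> every \<open>mu l\<close> is at
    most \<open>mu i\<close>.\<close>
  define J where "J = {1..i}"
  define K where "K = {1..<i}"
  have "J \<subseteq> {1..N}" "K \<subseteq> {1..N}" "card K < card J" "\<And>j. j \<in> J \<Longrightarrow> lam j \<noteq> 0"
    using i pos by (auto simp: J_def K_def less_imp_neq[symmetric])
  from weights_of_dimension_count[OF w u inv this(1,4,2,3)] obtain p q :: "nat \<Rightarrow> real" where
    pq: "\<And>j. 0 \<le> p j" "\<And>l. 0 \<le> q l" "0 < (\<Sum>j\<in>J. p j)" "(\<Sum>l\<in>{1..N}-K. q l) = (\<Sum>j\<in>J. p j)"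
    "(\<Sum>l\<in>{1..N}-K. mu l * q l) = (\<Sum>j\<in>J. - 2 / lam j * p j)" by blast
  have "- 2 / lam i * (\<Sum>j\<in>J. p j) = (\<Sum>j\<in>J. - 2 / lam i * p j)" by (simp add: sum_distrib_left)
  also have "\<dots> \<le> (\<Sum>l\<in>{1..N}-K. mu l * q l)"
    unfolding pq(5) using i by (intro sum_mono mult_right_mono mono pq) (auto simp: J_def)
  also have "\<dots> \<le> (\<Sum>l\<in>{1..N}-K. mu i * q l)"
    using i by (intro sum_mono mult_right_mono mu_dec pq) (auto simp: K_def)
  also have "\<dots> = mu i * (\<Sum>j\<in>J. p j)"
    by (simp add: sum_distrib_left flip: pq(4))
  finally show "- 2 / lam i \<le> mu i" using pq(3) by (simp only: mult_le_cancel_right_pos)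
qed

section \<open>Edge cuts and paths in trees\<close>

context pair_graph
begin

text \<open>A path never returns to its first vertex, so its first edge cannot recur in either
  direction.\<close>

lemma path_step_not_reused:
  assumes "apath u ((u', v) # p) w"
  shows "{u', v} \<notin> (\<lambda>(u, v). {u, v}) ` set p"
proof
  assume "{u', v} \<in> (\<lambda>(u, v). {u, v}) ` set p"
  then obtain x y where xy: "(x, y) \<in> set p" "{u', v} = {x, y}" by auto
  have p: "apath v p w" "u' \<notin> set (awalk_verts v p)" using assms by (auto simp: apath_Cons_iff)
  then have "set (awalk_verts v p) = {v} \<union> fst ` set p \<union> snd ` set p"
    using set_awalk_verts[of v p w] by (simp add: apath_def)
  then have "x \<in> set (awalk_verts v p)" "y \<in> set (awalk_verts v p)" using xy(1) by force+
  then show False using xy(2) p(2) by (auto simp: doubleton_eq_iff)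
qed

text \<open>Only steps along \<open>e\<close> change sides, and a path takes at most one such step.
  It therefore uses \<open>e\<close> exactly if its ends lie on different sides.\<close>

lemma apath_crosses_cut:
  assumes cut: "\<And>x y. (x, y) \<in> parcs G \<Longrightarrow> (x \<in> A) \<noteq> (y \<in> A) \<longleftrightarrow> {x, y} = e"
    and "apath u p v"
  shows "e \<in> (\<lambda>(u, v). {u, v}) ` set p \<longleftrightarrow> (u \<in> A) \<noteq> (v \<in> A)"
  using assms(2)
proof (induction p arbitrary: u)
  case Nil
  then show ?case by (simp add: apath_Nil_iff)
next
  case (Cons a p)
  obtain w where a: "a = (u, w)" "(u, w) \<in> parcs G" "apath w p v"
    using Cons.prems by (cases a) (auto simp: apath_Cons_iff)
  have "{u, w} \<notin> (\<lambda>(u, v). {u, v}) ` set p"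
    using Cons.prems a by (intro path_step_not_reused) auto
  moreover have "e \<in> (\<lambda>(u, v). {u, v}) ` set (a # p) \<longleftrightarrow> e = {u, w} \<or> e \<in> (\<lambda>(u, v). {u, v}) ` set p"
    by (simp add: a(1))
  ultimately show ?case using Cons.IH[OF a(3)] cut[OF a(2)] by metis
qed

end

section \<open>Cuts and unique paths in an undirected tree\<close>

context
  fixes T :: "'a pair_pre_digraph"
  assumes tree: "undirected_tree T"
begin

interpretation pair_graph T
  using tree by (simp add: undirected_tree_def)

lemma no_cycle: "cycle p \<Longrightarrow> length p < 3"
  using tree by (force simp: undirected_tree_def)

lemma tree_edgeD: "{u, v} \<in> undirected_edges T \<Longrightarrow> (u, v) \<in> parcs T"
  by (auto simp: undirected_edges_def doubleton_eq_iff intro: arcs_symmetric)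

lemma tree_apath_exists:
  assumes "u \<in> pverts T" "v \<in> pverts T"
  shows "\<exists>p. apath u p v"
proof -
  have "strongly_connected T"
    using tree sym_arcs by (intro symmetric_connected_imp_strongly_connected)
      (auto simp: undirected_tree_def)
  then have "u \<rightarrow>\<^sup>*\<^bsub>T\<^esub> v" using assms by (simp add: strongly_connected_def)
  then show ?thesis by (simp add: reachable_apath)
qed

text \<open>The set \<open>A\<close> is the component of \<open>p\<close> after removal of the edge \<open>{p, q}\<close>.\<close>

lemma edge_cut_exists:
  assumes pq: "(p, q) \<in> parcs T"
  obtains A where "p \<in> A" "q \<notin> A"
    "\<And>x y. (x, y) \<in> parcs T \<Longrightarrow> (x \<in> A) \<noteq> (y \<in> A) \<longleftrightarrow> {x, y} = {p, q}"
proof -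
  define A where "A = {v. \<exists>w. awalk p w v \<and> {p, q} \<notin> (\<lambda>(u, v). {u, v}) ` set w}"
  have "p \<in> pverts T" using pq by (auto dest: in_arcsD1)
  then have "p \<in> A" by (auto simp: A_def awalk_Nil_iff intro!: exI[of _ "[]"])
  have "p \<noteq> q" using pq by (rule no_loops')
  have "q \<notin> A"
  proof
    assume "q \<in> A"
    then obtain w where w: "awalk p w q" "{p, q} \<notin> (\<lambda>(u, v). {u, v}) ` set w"
      by (auto simp: A_def)
    \<comment> \<open>Shortened to a path, the walk still avoids \<open>{p, q}\<close>, so it has at
      least two arcs. Together with the arc from \<open>q\<close> back to \<open>p\<close> it forms
      a forbidden cycle of length at least three.\<close>
    define r where "r = awalk_to_apath w"
    have r: "apath p r q" "set r \<subseteq> set w"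
      using w(1) by (auto simp: r_def apath_awalk_to_apath awalk_to_apath_subset)
    have "r \<noteq> []" using r(1) \<open>p \<noteq> q\<close> by (auto simp: apath_Nil_iff)
    moreover have "r \<noteq> [(p, q)]" using r(2) w(2) by auto
    moreover have "r \<noteq> [a]" if "a \<noteq> (p, q)" for a
      using r(1) that by (cases a) (auto simp: apath_simps)
    ultimately have "2 \<le> length r" by (cases r rule: list.exhaust; cases "tl r") auto
    have "awalk q ((q, p) # r) q"
      using r(1) pq by (auto simp: awalk_Cons_iff apath_def intro: arcs_symmetric)
    then have "cycle ((q, p) # r)"
      using r(1) unfolding cycle_def by (intro exI[of _ q]) (auto simp: apath_def)
    from no_cycle[OF this] \<open>2 \<le> length r\<close> show False by simp
  qed
  \<comment> \<open>\<open>A\<close> can be left only along \<open>{p, q}\<close>, as a walk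
    avoiding that edge may be prolonged by any other one.\<close>
  have step: "y \<in> A" if xy: "(x, y) \<in> parcs T" "x \<in> A" "{x, y} \<noteq> {p, q}" for x y
  proof -
    obtain w where "awalk p w x" "{p, q} \<notin> (\<lambda>(u, v). {u, v}) ` set w"
      using xy(2) by (auto simp: A_def)
    moreover have "awalk x [(x, y)] y" using arc_implies_awalk[of "(x, y)"] xy(1) by simp
    ultimately show ?thesis using xy(3)
      unfolding A_def by (intro CollectI exI[of _ "w @ [(x, y)]"]) (auto intro: awalk_appendI simp del: awalk_append_iff)
  qed
  show thesis
  proof (rule that[of A])
    fix x y assume xy: "(x, y) \<in> parcs T"
    show "(x \<in> A) \<noteq> (y \<in> A) \<longleftrightarrow> {x, y} = {p, q}"
      using step[OF xy] step[OF arcs_symmetric[OF xy]] \<open>p \<in> A\<close> \<open>q \<notin> A\<close>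
      by (auto simp: doubleton_eq_iff insert_commute)
  qed fact+
qed

text \<open>The first edge of one path separates its ends, so the other path crosses the same cut
  and contains this edge too. Since the other path does not revisit \<open>u\<close>, it must start
  with that edge, and induction handles the remainders.\<close>

lemma tree_apath_unique:
  assumes "apath u p v" "apath u p' v"
  shows "p = p'"
  using assms
proof (induction p arbitrary: u p')
  case Nil
  then show ?case using apath_nonempty_ends by (metis apath_Nil_iff)
next
  case (Cons a p)
  obtain w where a: "a = (u, w)" "(u, w) \<in> parcs T" "apath w p v"
    using Cons.prems(1) by (cases a) (auto simp: apath_Cons_iff)
  obtain A where A: "\<And>x y. (x, y) \<in> parcs T \<Longrightarrow> (x \<in> A) \<noteq> (y \<in> A) \<longleftrightarrow> {x, y} = {u, w}"
    using edge_cut_exists[OF a(2)] by metis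
  have "{u, w} \<in> (\<lambda>(u, v). {u, v}) ` set (a # p)" using a(1) by simp
  then have mem: "{u, w} \<in> (\<lambda>(u, v). {u, v}) ` set p'"
    using apath_crosses_cut[OF A Cons.prems(1)] apath_crosses_cut[OF A Cons.prems(2)] by blast
  then obtain b q where p': "p' = b # q" by (cases p') auto
  obtain w' where b: "b = (u, w')" "apath w' q v" "u \<notin> set (awalk_verts w' q)"
    using Cons.prems(2) unfolding p' by (cases b) (auto simp: apath_Cons_iff)
  have "set (awalk_verts w' q) = {w'} \<union> fst ` set q \<union> snd ` set q"
    using set_awalk_verts[of w' q v] b(2) by (simp add: apath_def)
  then have "{u, w} \<notin> (\<lambda>(u, v). {u, v}) ` set q"
    using b(3) by (force simp: doubleton_eq_iff)
  then have "{u, w} = {u, w'}" using mem by (auto simp: p' b(1))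
  then have "w' = w" by (auto simp: doubleton_eq_iff)
  then show ?case using Cons.IH[OF a(3)] b(1,2) a(1) p' by auto
qed

lemma mem_path_edges_iff:
  assumes cut: "\<And>x y. (x, y) \<in> parcs T \<Longrightarrow> (x \<in> A) \<noteq> (y \<in> A) \<longleftrightarrow> {x, y} = e"
    and "i \<in> pverts T" "j \<in> pverts T"
  shows "e \<in> path_edges T i j \<longleftrightarrow> (i \<in> A) \<noteq> (j \<in> A)"
proof -
  obtain p where p: "apath i p j" using tree_apath_exists assms by blast
  then have "(THE p. apath i p j) = p" using tree_apath_unique by blast
  then show ?thesis using apath_crosses_cut[OF cut p] by (simp add: path_edges_def)
qed

lemma path_edges_subset:
  assumes "i \<in> pverts T" "j \<in> pverts T"
  shows "path_edges T i j \<subseteq> undirected_edges T"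
proof -
  obtain p where p: "apath i p j" using tree_apath_exists assms by blast
  then have "(THE p. apath i p j) = p" using tree_apath_unique by blast
  moreover have "set p \<subseteq> parcs T" using p by (auto simp: apath_def awalk_def)
  ultimately show ?thesis by (auto simp: path_edges_def undirected_edges_def)
qed

text \<open>A single set per edge describes both the incidences and the paths; the existential form
  allows a choice for all edges at once.\<close>

lemma tree_edge_cut:
  assumes "e \<in> undirected_edges T"
  shows "\<exists>p q A. e = {p, q} \<and> p \<in> pverts T \<and> q \<in> pverts T \<and> p \<in> A \<and> q \<notin> A \<and>
    (\<forall>x y. {x, y} \<in> undirected_edges T \<longrightarrow> ((x \<in> A) \<noteq> (y \<in> A) \<longleftrightarrow> {x, y} = e)) \<and>
    (\<forall>i\<in>pverts T. \<forall>j\<in>pverts T. e \<in> path_edges T i j \<longleftrightarrow> (i \<in> A) \<noteq> (j \<in> A))"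
proof -
  obtain p q where pq: "e = {p, q}" "(p, q) \<in> parcs T"
    using assms by (auto simp: undirected_edges_def)
  obtain A where A: "p \<in> A" "q \<notin> A"
    "\<And>x y. (x, y) \<in> parcs T \<Longrightarrow> (x \<in> A) \<noteq> (y \<in> A) \<longleftrightarrow> {x, y} = e"
    using edge_cut_exists[OF pq(2)] pq(1) by metis
  show ?thesis
    using pq A mem_path_edges_iff[OF A(3)] tree_edgeD
    by (intro exI[of _ p] exI[of _ q] exI[of _ A]) (auto dest: in_arcsD1 in_arcsD2)
qed

text \<open>Connectedness propagates equality along a walk. This will identify the vectors on which
  the Laplacian form vanishes as constant across vertices.\<close>

lemma tree_potential_constant:
  assumes "\<And>x y. {x, y} \<in> undirected_edges T \<Longrightarrow> f x = f y"
    and "u \<in> pverts T" "v \<in> pverts T"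
  shows "f u = f v"
proof -
  obtain p where "awalk u p v" using tree_apath_exists assms(2,3) by (auto simp: apath_def)
  then show ?thesis
  proof (induction p arbitrary: u)
    case Nil
    then show ?case by (simp add: awalk_Nil_iff)
  next
    case (Cons a p)
    obtain w where "(u, w) \<in> parcs T" "awalk w p v"
      using Cons.prems by (cases a) (auto simp: awalk_Cons_iff)
    then show ?case using Cons.IH[of w] assms(1)[of u w] by (force simp: undirected_edges_def)
  qed
qed

lemma tree_finite_edges: "finite (undirected_edges T)"
  by (simp add: undirected_edges_def)

end

section \<open>Block forms of distance and Laplacian matrix\<close>

lemma sum_blocks: "(\<Sum>a<n * s. f a) = (\<Sum>i<n. \<Sum>k<s. f (i * s + k))"
  for f :: "nat \<Rightarrow> 'a::comm_monoid_add"
proof -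
  have "(\<Sum>a<n * s. f a) = (\<Sum>i<n. sum f {i * s..<i * s + s})"
    by (rule sum.nat_group[symmetric])
  also have "\<dots> = (\<Sum>i<n. \<Sum>k<s. f (i * s + k))"
    using sum.atLeastLessThan_shift_0[of f "i * s" "i * s + s" for i]
    by (simp add: lessThan_atLeast0 comp_def)
  finally show ?thesis .
qed

lemma block_index_less:
  fixes i k n s :: nat
  assumes "i < n" "k < s"
  shows "i * s + k < n * s"
proof -
  have "i * s + k < Suc i * s" using assms by simp
  also have "\<dots> \<le> n * s" using assms by (intro mult_le_mono1) simp
  finally show ?thesis .
qed

lemma quad_form_blocks:
  "quad_form (n * s) A x =
    (\<Sum>i<n. \<Sum>k<s. \<Sum>j<n. \<Sum>l<s. x (i * s + k) * A $$ (i * s + k, j * s + l) * x (j * s + l))"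
  by (simp add: quad_form_def sum_blocks)

section \<open>Quadratic forms from weighted incidence data\<close>

lemma sum_mult_const_of_bool:
  fixes f :: "'a \<Rightarrow> real"
  assumes "finite S" "b \<in> S"
  shows "(\<Sum>a\<in>S. of_bool (b = a) * f a) = f b"
  using sum_of_bool_mult[OF assms, of f] by (simp add: mult.commute eq_commute[of b])

text \<open>
  \<open>d e\<close> is the signed incidence vector of the edge \<open>e\<close> and \<open>a e\<close> the indicator of one side of the cut
  that the removal of \<open>e\<close> makes; \<open>V e\<close> and \<open>W e\<close> are the weight of \<open>e\<close> in the Laplacian and in the
  distance matrix. The factor \<open>a e i + a e j - 2 * a e i * a e j\<close> below is 1 if \<open>e\<close> separates \<open>i\<close> from
  \<open>j\<close>, and 0 otherwise.
\<close>

locale weighted_incidence =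
  fixes n s :: nat and E :: "'e set" and d a :: "'e \<Rightarrow> nat \<Rightarrow> real"
    and V W :: "'e \<Rightarrow> nat \<Rightarrow> nat \<Rightarrow> real"
  assumes finite_E: "finite E"
    and incidence_total: "e \<in> E \<Longrightarrow> (\<Sum>i<n. d e i) = 0"
    and cut_incidence: "e \<in> E \<Longrightarrow> f \<in> E \<Longrightarrow> (\<Sum>i<n. a e i * d f i) = of_bool (e = f)"
    and weight_inverse: "e \<in> E \<Longrightarrow> k < s \<Longrightarrow> m < s \<Longrightarrow> (\<Sum>l<s. W e k l * V e l m) = of_bool (k = m)"
begin

text \<open>The factorization of the Laplacian through the signed incidence matrix, with
  \<open>i\<close>, \<open>j\<close> naming the block and \<open>k\<close>, \<open>l\<close> the
  entry in it.\<close>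

definition laplace :: "nat \<Rightarrow> nat \<Rightarrow> nat \<Rightarrow> nat \<Rightarrow> real" where
  "laplace i k j l = (\<Sum>e\<in>E. d e i * d e j * V e k l)"

definition distance :: "nat \<Rightarrow> nat \<Rightarrow> nat \<Rightarrow> nat \<Rightarrow> real" where
  "distance i k j l = (\<Sum>e\<in>E. (a e i + a e j - 2 * a e i * a e j) * W e k l)"

text \<open>Network terms: \<open>y\<close> is a vector-valued potential, its tension the difference
  across an edge, and \<open>flow\<close> the tension multiplied by the matrix conductance
  \<open>V e\<close>.\<close>

definition tension :: "(nat \<Rightarrow> nat \<Rightarrow> real) \<Rightarrow> 'e \<Rightarrow> nat \<Rightarrow> real" where
  "tension y e k = (\<Sum>j<n. d e j * y j k)"

definition flow :: "(nat \<Rightarrow> nat \<Rightarrow> real) \<Rightarrow> 'e \<Rightarrow> nat \<Rightarrow> real" where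
  "flow y e k = (\<Sum>l<s. V e k l * tension y e l)"

lemma laplace_apply: "(\<Sum>j<n. \<Sum>l<s. laplace i k j l * y j l) = (\<Sum>e\<in>E. d e i * flow y e k)"
proof -
  have "(\<Sum>j<n. \<Sum>l<s. laplace i k j l * y j l)
      = (\<Sum>j<n. \<Sum>l<s. \<Sum>e\<in>E. d e i * (V e k l * (d e j * y j l)))"
    by (simp add: laplace_def sum_distrib_left sum_distrib_right mult_ac)
  also have "\<dots> = (\<Sum>e\<in>E. \<Sum>l<s. \<Sum>j<n. d e i * (V e k l * (d e j * y j l)))"
    by (simp only: sum.swap[of _ _ "{..<n}"] sum.swap[of _ E "{..<s}"])
  also have "\<dots> = (\<Sum>e\<in>E. d e i * flow y e k)"
    by (simp add: flow_def tension_def sum_distrib_left)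
  finally show ?thesis .
qed

lemma laplace_quad:
  "(\<Sum>i<n. \<Sum>k<s. \<Sum>j<n. \<Sum>l<s. y i k * laplace i k j l * y j l)
    = (\<Sum>e\<in>E. \<Sum>k<s. tension y e k * flow y e k)"
proof -
  have "(\<Sum>i<n. \<Sum>k<s. \<Sum>j<n. \<Sum>l<s. y i k * laplace i k j l * y j l)
      = (\<Sum>i<n. \<Sum>k<s. y i k * (\<Sum>j<n. \<Sum>l<s. laplace i k j l * y j l))"
    by (simp add: sum_distrib_left mult.assoc)
  also have "\<dots> = (\<Sum>i<n. \<Sum>k<s. \<Sum>e\<in>E. d e i * y i k * flow y e k)"
    unfolding laplace_apply by (simp add: sum_distrib_left mult_ac)
  also have "\<dots> = (\<Sum>e\<in>E. \<Sum>k<s. \<Sum>i<n. d e i * y i k * flow y e k)"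
    by (simp only: sum.swap[of _ _ "{..<n}"] sum.swap[of _ E "{..<s}"])
  also have "\<dots> = (\<Sum>e\<in>E. \<Sum>k<s. tension y e k * flow y e k)"
    by (simp add: tension_def sum_distrib_right)
  finally show ?thesis .
qed

lemma weight_flow:
  assumes "e \<in> E" "k < s"
  shows "(\<Sum>l<s. W e k l * flow y e l) = tension y e k"
proof -
  have "(\<Sum>l<s. W e k l * flow y e l) = (\<Sum>m<s. (\<Sum>l<s. W e k l * V e l m) * tension y e m)"
    unfolding flow_def sum_distrib_left sum_distrib_right
    by (subst sum.swap) (simp add: mult_ac)
  also have "\<dots> = (\<Sum>m<s. of_bool (k = m) * tension y e m)"
    using assms by (intro sum.cong) (auto simp: weight_inverse)
  also have "\<dots> = tension y e k" using assms by (intro sum_mult_const_of_bool) auto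
  finally show ?thesis .
qed

text \<open>When the separation factor is expanded, the terms in \<open>a e i\<close> alone and
  \<open>a e j\<close> alone carry a total of \<open>x\<close> as a factor and vanish; the product
  term remains.\<close>

lemma distance_quad:
  assumes total: "\<And>k. k < s \<Longrightarrow> (\<Sum>i<n. x i k) = 0"
  shows "(\<Sum>i<n. \<Sum>k<s. \<Sum>j<n. \<Sum>l<s. x i k * distance i k j l * x j l)
    = (\<Sum>e\<in>E. \<Sum>k<s. \<Sum>l<s. - 2 * W e k l * (\<Sum>i<n. a e i * x i k) * (\<Sum>j<n. a e j * x j l))"
proof -
  have split: "(\<Sum>i<n. \<Sum>j<n. x i k * ((a e i + a e j - 2 * a e i * a e j) * W e k l) * x j l)
      = - 2 * W e k l * (\<Sum>i<n. a e i * x i k) * (\<Sum>j<n. a e j * x j l)"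
    if "k < s" "l < s" for e k l
  proof -
    have "(\<Sum>i<n. \<Sum>j<n. x i k * ((a e i + a e j - 2 * a e i * a e j) * W e k l) * x j l)
        = (\<Sum>i<n. \<Sum>j<n. W e k l * ((a e i * x i k) * x j l)
            + W e k l * (x i k * (a e j * x j l))
            + - 2 * W e k l * ((a e i * x i k) * (a e j * x j l)))"
      by (intro sum.cong refl) (simp add: algebra_simps)
    also have "\<dots> = W e k l * ((\<Sum>i<n. a e i * x i k) * (\<Sum>j<n. x j l))
        + W e k l * ((\<Sum>i<n. x i k) * (\<Sum>j<n. a e j * x j l))
        + - 2 * W e k l * ((\<Sum>i<n. a e i * x i k) * (\<Sum>j<n. a e j * x j l))"
      by (simp only: sum.distrib flip: sum_distrib_left sum_distrib_right)
    also have "\<dots> = - 2 * W e k l * ((\<Sum>i<n. a e i * x i k) * (\<Sum>j<n. a e j * x j l))"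
      using total that by simp
    finally show ?thesis by simp
  qed
  have "(\<Sum>i<n. \<Sum>k<s. \<Sum>j<n. \<Sum>l<s. x i k * distance i k j l * x j l)
      = (\<Sum>i<n. \<Sum>k<s. \<Sum>j<n. \<Sum>l<s. \<Sum>e\<in>E. x i k * ((a e i + a e j - 2 * a e i * a e j) * W e k l) * x j l)"
    by (simp only: distance_def sum_distrib_left sum_distrib_right)
  also have "\<dots> = (\<Sum>k<s. \<Sum>l<s. \<Sum>e\<in>E. \<Sum>i<n. \<Sum>j<n. x i k * ((a e i + a e j - 2 * a e i * a e j) * W e k l) * x j l)"
    by (simp only: sum.swap[of _ "{..<s}" "{..<n}"] sum.swap[of _ E "{..<n}"])
  also have "\<dots> = (\<Sum>k<s. \<Sum>l<s. \<Sum>e\<in>E. - 2 * W e k l * (\<Sum>i<n. a e i * x i k) * (\<Sum>j<n. a e j * x j l))"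
    by (intro sum.cong refl split) auto
  also have "\<dots> = (\<Sum>k<s. \<Sum>e\<in>E. \<Sum>l<s. - 2 * W e k l * (\<Sum>i<n. a e i * x i k) * (\<Sum>j<n. a e j * x j l))"
    by (intro sum.cong refl sum.swap)
  also have "\<dots> = (\<Sum>e\<in>E. \<Sum>k<s. \<Sum>l<s. - 2 * W e k l * (\<Sum>i<n. a e i * x i k) * (\<Sum>j<n. a e j * x j l))"
    by (rule sum.swap)
  finally show ?thesis .
qed

text \<open>The identity \<open>L D L = - 2 L\<close> at the level of quadratic forms. The image
  \<open>x\<close> has zero totals because each incidence vector does, and weighting it by
  \<open>a e\<close> isolates the flow through \<open>e\<close> by \<open>cut_incidence\<close>. The
  weight then turns one flow factor back into a tension.\<close>

lemma distance_quad_laplace: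
  fixes y :: "nat \<Rightarrow> nat \<Rightarrow> real"
  defines "x \<equiv> \<lambda>i k. \<Sum>j<n. \<Sum>l<s. laplace i k j l * y j l"
  shows "(\<Sum>i<n. \<Sum>k<s. \<Sum>j<n. \<Sum>l<s. x i k * distance i k j l * x j l)
    = - 2 * (\<Sum>i<n. \<Sum>k<s. \<Sum>j<n. \<Sum>l<s. y i k * laplace i k j l * y j l)"
proof -
  have x: "x i k = (\<Sum>f\<in>E. d f i * flow y f k)" for i k
    by (simp add: x_def laplace_apply)
  have total: "(\<Sum>i<n. x i k) = 0" for k
    unfolding x by (subst sum.swap) (simp add: incidence_total flip: sum_distrib_right)
  have cut: "(\<Sum>i<n. a e i * x i k) = flow y e k" if "e \<in> E" for e k
  proof -
    have "(\<Sum>i<n. a e i * x i k) = (\<Sum>f\<in>E. (\<Sum>i<n. a e i * d f i) * flow y f k)"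
      unfolding x sum_distrib_left sum_distrib_right by (subst sum.swap) (simp add: mult_ac)
    also have "\<dots> = (\<Sum>f\<in>E. of_bool (e = f) * flow y f k)"
      using that by (intro sum.cong) (auto simp: cut_incidence)
    also have "\<dots> = flow y e k" using that finite_E by (intro sum_mult_const_of_bool) auto
    finally show ?thesis .
  qed
  have "(\<Sum>i<n. \<Sum>k<s. \<Sum>j<n. \<Sum>l<s. x i k * distance i k j l * x j l)
      = (\<Sum>e\<in>E. \<Sum>k<s. \<Sum>l<s. - 2 * W e k l * flow y e k * flow y e l)"
    unfolding distance_quad[OF total] by (intro sum.cong refl) (simp add: cut)
  also have "\<dots> = (\<Sum>e\<in>E. \<Sum>k<s. - 2 * flow y e k * (\<Sum>l<s. W e k l * flow y e l))"
    by (simp add: sum_distrib_left mult_ac)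
  also have "\<dots> = (\<Sum>e\<in>E. \<Sum>k<s. - 2 * (tension y e k * flow y e k))"
    by (intro sum.cong refl) (simp add: weight_flow)
  finally show ?thesis unfolding laplace_quad by (simp add: sum_distrib_left)
qed

end

section \<open>Inverses of positive definite weights\<close>

text \<open>A nonzero kernel vector would give the form the value 0, so the determinant is nonzero,
  \<open>mat_inverse\<close> returns \<open>Some\<close>, and \<open>inv_mat\<close> is the true
  inverse.\<close>

lemma inv_mat_inverse:
  assumes W: "pos_def_mat s W"
  shows "inv_mat W \<in> carrier_mat s s" "W * inv_mat W = 1\<^sub>m s"
proof -
  have carr: "W \<in> carrier_mat s s" using W by (simp add: pos_def_mat_def)
  have "det W \<noteq> 0"
  proof
    assume "det W = 0"
    then obtain v where "v \<in> carrier_vec s" "v \<noteq> 0\<^sub>v s" "W *\<^sub>v v = 0\<^sub>v s"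
      using det_0_iff_vec_prod_zero_field[OF carr] by blast
    then show False using W by (force simp: pos_def_mat_def)
  qed
  then have "mat_inverse W \<noteq> None"
    using mat_inverse(1)[OF carr, of "()"] det_non_zero_imp_unit[OF carr, of "()"] by blast
  then have "mat_inverse W = Some (inv_mat W)" by (auto simp: inv_mat_def)
  from mat_inverse(2)[OF carr this]
  show "inv_mat W \<in> carrier_mat s s" "W * inv_mat W = 1\<^sub>m s" by auto
qed

text \<open>The substitution \<open>u = V *\<^sub>v v\<close> turns the form of the inverse at
  \<open>v\<close> into the form of \<open>W\<close> at \<open>u\<close>.\<close>

lemma pos_def_inv_mat:
  assumes W: "pos_def_mat s W"
  shows "pos_def_mat s (inv_mat W)"
proof -
  define V where "V = inv_mat W"
  note V = inv_mat_inverse[OF W, folded V_def]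
  have Wc: "W \<in> carrier_mat s s" and Wt: "transpose_mat W = W"
    and Wpos: "\<And>v. v \<in> carrier_vec s \<Longrightarrow> v \<noteq> 0\<^sub>v s \<Longrightarrow> 0 < v \<bullet> (W *\<^sub>v v)"
    using W by (auto simp: pos_def_mat_def)
  \<comment> \<open>Transposing \<open>W * V = 1\<^sub>m s\<close> makes the transpose of
    \<open>V\<close> a left inverse of \<open>W\<close>, which must agree with the right inverse
    \<open>V\<close>.\<close>
  have Vt: "transpose_mat V = V"
  proof -
    have "transpose_mat V * W = 1\<^sub>m s"
      using transpose_mult[OF Wc V(1)] V(2) Wt by simp
    then have "transpose_mat V * W * V = V" using V(1) by simp
    moreover have "transpose_mat V * W * V = transpose_mat V * (W * V)"
      using V(1) Wc by (intro assoc_mult_mat[of _ s s _ s _ s]) auto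
    ultimately show ?thesis using V by simp
  qed
  have "0 < v \<bullet> (V *\<^sub>v v)" if v: "v \<in> carrier_vec s" "v \<noteq> 0\<^sub>v s" for v
  proof -
    define u where "u = V *\<^sub>v v"
    have u: "u \<in> carrier_vec s" using V(1) v by (simp add: u_def)
    have Wu: "W *\<^sub>v u = v"
      using assoc_mult_mat_vec[OF Wc V(1) v(1)] V(2) v by (simp add: u_def)
    have "u \<noteq> 0\<^sub>v s" using Wu v Wc by auto
    then have "0 < u \<bullet> v" using Wpos[OF u] Wu by simp
    then show ?thesis using u v by (simp add: u_def[symmetric] comm_scalar_prod[of _ s])
  qed
  then show ?thesis using V Vt by (simp add: pos_def_mat_def V_def)
qed

lemma pos_def_quad:
  assumes "pos_def_mat s V"
  shows "0 \<le> (\<Sum>k<s. t k * (\<Sum>l<s. V $$ (k, l) * t l))"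
    and "(\<Sum>k<s. t k * (\<Sum>l<s. V $$ (k, l) * t l)) \<le> 0 \<Longrightarrow> k < s \<Longrightarrow> t k = 0"
proof -
  have V: "V \<in> carrier_mat s s" "\<And>v. v \<in> carrier_vec s \<Longrightarrow> v \<noteq> 0\<^sub>v s \<Longrightarrow> 0 < v \<bullet> (V *\<^sub>v v)"
    using assms by (auto simp: pos_def_mat_def)
  define v where "v = vec s t"
  have v: "v \<in> carrier_vec s" by (simp add: v_def)
  have eq: "(\<Sum>k<s. t k * (\<Sum>l<s. V $$ (k, l) * t l)) = v \<bullet> (V *\<^sub>v v)"
    using V(1) by (auto simp: v_def scalar_prod_def lessThan_atLeast0 intro!: sum.cong)
  show "0 \<le> (\<Sum>k<s. t k * (\<Sum>l<s. V $$ (k, l) * t l))"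
  proof (cases "v = 0\<^sub>v s")
    case True
    then show ?thesis using V(1) unfolding eq by simp
  qed (use V(2)[OF v] eq in simp)
  assume "(\<Sum>k<s. t k * (\<Sum>l<s. V $$ (k, l) * t l)) \<le> 0" "k < s"
  then have "v = 0\<^sub>v s" using V(2)[OF v] eq by fastforce
  then have "v $ k = 0" using \<open>k < s\<close> by simp
  then show "t k = 0" using \<open>k < s\<close> by (simp add: v_def)
qed

section \<open>Identification with the matrices of the tree\<close>

lemma symmetric_blocksI:
  fixes A :: "real mat"
  assumes "A \<in> carrier_mat (n * s) (n * s)"
    and "\<And>i k j l. i < n \<Longrightarrow> k < s \<Longrightarrow> j < n \<Longrightarrow> l < s \<Longrightarrow>
      A $$ (i * s + k, j * s + l) = A $$ (j * s + l, i * s + k)"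
  shows "transpose_mat A = A"
proof (rule eq_matI)
  fix a b assume "a < dim_row A" "b < dim_col A"
  then have ab: "a < n * s" "b < n * s" using assms(1) by auto
  then have "s > 0" by (cases s) auto
  with ab have "a div s < n" "a mod s < s" "b div s < n" "b mod s < s"
    by (auto simp: less_mult_imp_div_less)
  from assms(2)[OF this] have "A $$ (a, b) = A $$ (b, a)" by simp
  then show "transpose_mat A $$ (a, b) = A $$ (a, b)" using ab assms(1) by simp
qed (use assms(1) in auto)

lemma block_mat_index:
  assumes "i < n" "k < s" "j < n" "l < s"
  shows "block_mat n s B $$ (i * s + k, j * s + l) = B i j $$ (k, l)"
  using assms by (simp add: block_mat_def block_index_less)

theorem theorem3p6:
  fixes n s :: nat
    and T :: "nat pair_pre_digraph"
    and W :: "nat set \<Rightarrow> real mat"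
    and mu lam :: "nat \<Rightarrow> real"
  assumes "n \<ge> 2" and "s \<ge> 1"
    and "undirected_tree T" and "pverts T = {0..<n}"
    and "\<And>e. e \<in> undirected_edges T \<Longrightarrow> pos_def_mat s (W e)"
    and "eigenvalues_decreasing (n * s) (distance_mat n s T W) mu"
    and "eigenvalues_decreasing (n * s) (laplacian_mat n s T W) lam"
  shows "\<forall>i\<in>{1..n * s - s}. mu (s + i) \<le> - 2 / lam i \<and> - 2 / lam i \<le> mu i"
proof -
  note tree = assms(3)
  define E where "E = undirected_edges T"
  define D where "D = distance_mat n s T W"
  define L where "L = laplacian_mat n s T W"
  have finE: "finite E" unfolding E_def by (rule tree_finite_edges[OF tree])
  have verts: "i \<in> pverts T \<longleftrightarrow> i < n" for i using assms(4) by simp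
  have "\<forall>e\<in>E. \<exists>p q A. e = {p, q} \<and> p < n \<and> q < n \<and> p \<in> A \<and> q \<notin> A \<and>
      (\<forall>x y. {x, y} \<in> E \<longrightarrow> ((x \<in> A) \<noteq> (y \<in> A) \<longleftrightarrow> {x, y} = e)) \<and>
      (\<forall>i<n. \<forall>j<n. e \<in> path_edges T i j \<longleftrightarrow> (i \<in> A) \<noteq> (j \<in> A))"
    using tree_edge_cut[OF tree] unfolding E_def Ball_def verts by blast
  then obtain p q A where pqA: "\<forall>e\<in>E. e = {p e, q e} \<and> p e < n \<and> q e < n \<and> p e \<in> A e \<and> q e \<notin> A e \<and>
      (\<forall>x y. {x, y} \<in> E \<longrightarrow> ((x \<in> A e) \<noteq> (y \<in> A e) \<longleftrightarrow> {x, y} = e)) \<and>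
      (\<forall>i<n. \<forall>j<n. e \<in> path_edges T i j \<longleftrightarrow> (i \<in> A e) \<noteq> (j \<in> A e))"
    unfolding bchoice_iff by (elim exE) (rule that)
  have e: "e = {p e, q e}" and pq: "p e < n" "q e < n" and pA: "p e \<in> A e" "q e \<notin> A e"
    and cut: "\<And>x y. {x, y} \<in> E \<Longrightarrow> (x \<in> A e) \<noteq> (y \<in> A e) \<longleftrightarrow> {x, y} = e"
    and path: "\<And>i j. i < n \<Longrightarrow> j < n \<Longrightarrow> e \<in> path_edges T i j \<longleftrightarrow> (i \<in> A e) \<noteq> (j \<in> A e)"
    if "e \<in> E" for e
    using bspec[OF pqA that] by simp_all
  \<comment> \<open>The positive end \<open>p e\<close> is the one inside \<open>A e\<close>, which
    makes the diagonal value in \<open>cut_incidence\<close> equal to 1.\<close>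
  define d :: "nat set \<Rightarrow> nat \<Rightarrow> real" where "d = (\<lambda>e i. of_bool (i = p e) - of_bool (i = q e))"
  define a :: "nat set \<Rightarrow> nat \<Rightarrow> real" where "a = (\<lambda>e i. of_bool (i \<in> A e))"
  define V where "V = (\<lambda>e k l. inv_mat (W e) $$ (k, l))"
  define U where "U = (\<lambda>e k l. W e $$ (k, l))"
  have Wpd: "pos_def_mat s (W e)" "pos_def_mat s (inv_mat (W e))" if "e \<in> E" for e
    using assms(5) pos_def_inv_mat that by (auto simp: E_def)
  have d_sum: "(\<Sum>i<n. f i * d e i) = f (p e) - f (q e)" if "e \<in> E" for e and f :: "nat \<Rightarrow> real"
    using pq[OF that] by (simp add: d_def right_diff_distrib sum_subtractf sum_of_bool_mult)
  interpret weighted_incidence n s E d a V U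
  proof
    show "(\<Sum>i<n. d e i) = 0" if "e \<in> E" for e
      using d_sum[OF that, of "\<lambda>_. 1"] by simp
    show "(\<Sum>i<n. a e i * d f i) = of_bool (e = f)" if "e \<in> E" "f \<in> E" for e f
    proof -
      \<comment> \<open>Any other edge has both ends on the same side of the cut of
        \<open>e\<close>, so its two contributions cancel.\<close>
      have "p f \<in> A e \<longleftrightarrow> q f \<in> A e" if "e \<noteq> f"
        using cut[of e "p f" "q f"] e[of f] that \<open>e \<in> E\<close> \<open>f \<in> E\<close> by auto
      moreover have "(\<Sum>i<n. a e i * d f i) = a e (p f) - a e (q f)"
        using that(2) by (rule d_sum)
      ultimately show ?thesis using pA that(2) by (auto simp: a_def)
    qed
    show "(\<Sum>l<s. U e k l * V e l m) = of_bool (k = m)" if "e \<in> E" "k < s" "m < s" for e k m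
    proof -
      have "W e \<in> carrier_mat s s" using Wpd[OF that(1)] by (simp add: pos_def_mat_def)
      then have "(\<Sum>l<s. U e k l * V e l m) = (W e * inv_mat (W e)) $$ (k, m)"
        using inv_mat_inverse(1)[OF Wpd(1)[OF that(1)]] that
        by (simp add: U_def V_def scalar_prod_def lessThan_atLeast0)
      then show ?thesis unfolding inv_mat_inverse(2)[OF Wpd(1)[OF that(1)]] using that by simp
    qed
  qed (fact finE)
  have D_index: "D $$ (i * s + k, j * s + l) = distance i k j l"
    if "i < n" "k < s" "j < n" "l < s" for i k j l
  proof -
    have "D $$ (i * s + k, j * s + l) = (\<Sum>e\<in>path_edges T i j. U e k l)"
      using that by (simp add: D_def distance_mat_def block_mat_index mat_sum_def U_def)
    \<comment> \<open>Extended by zero to all edges, the path indicator becomes the cut indicator in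
      \<open>distance\<close>.\<close>
    also have "\<dots> = (\<Sum>e\<in>E. if e \<in> path_edges T i j then U e k l else 0)"
      using path_edges_subset[OF tree, of i j] that finE
      by (simp add: verts E_def sum.inter_restrict[symmetric] Int_absorb1)
    also have "\<dots> = distance i k j l"
      unfolding distance_def using path that
      by (intro sum.cong) (auto simp: a_def)
    finally show ?thesis .
  qed
  have L_index: "L $$ (i * s + k, j * s + l) = laplace i k j l"
    if "i < n" "k < s" "j < n" "l < s" for i k j l
  proof -
    have pq_neq: "p e \<noteq> q e" if "e \<in> E" for e using pA[OF that] by auto
    have dimV: "dim_row (inv_mat (W e)) = s" "dim_col (inv_mat (W e)) = s" if "e \<in> E" for e
      using inv_mat_inverse(1)[OF Wpd(1)[OF that]] by auto
    \<comment> \<open>The sign of the product does not depend on the orientation of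
      \<open>e\<close>. Only the occurrences of \<open>e\<close> on the right are unfolded into its
      ends; those inside \<open>d\<close> stay.\<close>
    have dd: "d e i * d e j = (if i = j then of_bool (i \<in> e) else - of_bool ({i, j} = e))"
      if "e \<in> E" for e
      using pq_neq[OF that] by (subst (3 4) e[OF that]) (auto simp: d_def doubleton_eq_iff)
    show ?thesis
    proof (cases "i = j")
      case True
      have "L $$ (i * s + k, j * s + l) = (\<Sum>e\<in>{e \<in> E. i \<in> e}. V e k l)"
        using that True by (simp add: L_def laplacian_mat_def block_mat_index mat_sum_def V_def E_def)
      also have "\<dots> = (\<Sum>e\<in>E. if i \<in> e then V e k l else 0)"
        using finE by (rule sum.inter_filter)
      also have "\<dots> = laplace i k j l"
        unfolding laplace_def using True by (intro sum.cong refl, subst dd) auto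
      finally show ?thesis .
    next
      case False
      have "laplace i k j l = (\<Sum>e\<in>E. if {i, j} = e then - V e k l else 0)"
        unfolding laplace_def using False by (intro sum.cong refl, subst dd) auto
      also have "\<dots> = (if {i, j} \<in> E then - V {i, j} k l else 0)"
        using finE by simp
      also have "\<dots> = L $$ (i * s + k, j * s + l)"
        using that False dimV
        by (simp add: L_def laplacian_mat_def block_mat_index V_def flip: E_def)
      finally show ?thesis ..
    qed
  qed
  have symU: "U e k l = U e l k" and symV: "V e k l = V e l k" if "e \<in> E" "k < s" "l < s" for e k l
    using Wpd[OF that(1)] that(2,3) unfolding pos_def_mat_def U_def V_def
    by (metis carrier_matD index_transpose_mat(1))+
  have carr: "D \<in> carrier_mat (n * s) (n * s)" "L \<in> carrier_mat (n * s) (n * s)"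
    by (auto simp: D_def L_def distance_mat_def laplacian_mat_def block_mat_def)
  have symD: "transpose_mat D = D"
    by (rule symmetric_blocksI[OF carr(1)])
      (simp only: D_index, auto simp: distance_def symU algebra_simps intro!: sum.cong)
  have symL: "transpose_mat L = L"
    by (rule symmetric_blocksI[OF carr(2)])
      (simp only: L_index, auto simp: laplace_def symV mult_ac intro!: sum.cong)
  have mu: "eigenvalues_decreasing (n * s) D mu" and lam: "eigenvalues_decreasing (n * s) L lam"
    using assms by (auto simp: D_def L_def)
  obtain w where w: "orthonormal_eigenbasis (n * s) D mu w"
    using orthonormal_eigenbasis_exists[OF mu symD] .
  obtain u where u: "orthonormal_eigenbasis (n * s) L lam u"
    using orthonormal_eigenbasis_exists[OF lam symL] .
  have qL: "quad_form (n * s) L y =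
      (\<Sum>i<n. \<Sum>k<s. \<Sum>j<n. \<Sum>l<s. y (i * s + k) * laplace i k j l * y (j * s + l))" for y
    unfolding quad_form_blocks by (intro sum.cong refl) (simp add: L_index)
  have inv: "quad_form (n * s) D (\<lambda>a. \<Sum>b<n * s. L $$ (a, b) * y b) = - 2 * quad_form (n * s) L y"
    for y
    unfolding qL distance_quad_laplace[symmetric, of "\<lambda>i k. y (i * s + k)"]
    unfolding quad_form_blocks sum_blocks by (intro sum.cong refl) (simp add: L_index D_index)
  \<comment> \<open>Grounding vertex 0: the Laplacian form is a sum of nonnegative edge terms, so a
    nonpositive value forces every tension to vanish. All blocks of \<open>x\<close> then equal the
    block at vertex 0, which consists of the first \<open>s\<close> coordinates.\<close>
  have zero: "x b = 0"
    if x: "quad_form (n * s) L x \<le> 0" "\<And>k. k < s \<Longrightarrow> x k = 0" and b: "b < n * s" for x b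
  proof -
    let ?x = "\<lambda>i k. x (i * s + k)"
    have qe: "(\<Sum>k<s. tension ?x e k * flow ?x e k)
        = (\<Sum>k<s. tension ?x e k * (\<Sum>l<s. inv_mat (W e) $$ (k, l) * tension ?x e l))" for e
      unfolding flow_def by (simp add: V_def)
    have nonneg: "0 \<le> (\<Sum>k<s. tension ?x e k * flow ?x e k)" if "e \<in> E" for e
      unfolding qe using Wpd(2)[OF that] by (rule pos_def_quad)
    have "(\<Sum>k<s. tension ?x e k * flow ?x e k) \<le> 0" if "e \<in> E" for e
    proof -
      have "(\<Sum>k<s. tension ?x e k * flow ?x e k) \<le> (\<Sum>e\<in>E. \<Sum>k<s. tension ?x e k * flow ?x e k)"
        using that finE nonneg by (intro member_le_sum) auto
      also have "\<dots> \<le> 0"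
        using x(1) unfolding qL laplace_quad[of ?x] .
      finally show ?thesis .
    qed
    then have tension0: "tension ?x e k = 0" if "e \<in> E" "k < s" for e k
      using pos_def_quad(2)[OF Wpd(2)[OF that(1)], of "tension ?x e" k] that unfolding qe by simp
    have const: "?x i k = ?x 0 k" if "i < n" "k < s" for i k
    proof (rule tree_potential_constant[OF tree, where f = "\<lambda>i. ?x i k"])
      fix v v' assume "{v, v'} \<in> undirected_edges T"
      then have vE: "{v, v'} \<in> E" by (simp add: E_def)
      have "tension ?x {v, v'} k = ?x (p {v, v'}) k - ?x (q {v, v'}) k"
        using d_sum[OF vE, of "\<lambda>i. ?x i k"] by (simp add: tension_def mult.commute)
      then show "?x v k = ?x v' k"
        using tension0[OF vE that(2)] e[OF vE] by (auto simp: doubleton_eq_iff)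
    qed (use that assms(1) in \<open>auto simp: verts\<close>)
    have "b div s < n" "b mod s < s"
      using b assms(2) by (auto simp: less_mult_imp_div_less)
    from const[OF this] x(2)[OF this(2)] show ?thesis by simp
  qed
  have mu_dec: "mu j \<le> mu i" and lam_dec: "lam j \<le> lam i" if "1 \<le> i" "i \<le> j" "j \<le> n * s" for i j
    using mu lam that by (auto simp: eigenvalues_decreasing_def)
  \<comment> \<open>Positivity follows from \<open>zero\<close> by dimension counting;
    \<open>interlacing\<close> uses it for the order of the quotients
    \<open>- 2 / lam i\<close>.\<close>
  have pos: "0 < lam i" if "i \<in> {1..n * s - s}" for i
  proof (rule eigenvalue_positive[OF u, where s = s])
    show "x b = 0" if "quad_form (n * s) L x \<le> 0" "\<And>k. k < s \<Longrightarrow> x k = 0" "b < n * s" for x b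
      using that by (rule zero)
  qed (use that lam_dec in auto)
  show ?thesis
  proof (intro ballI conjI)
    fix i assume "i \<in> {1..n * s - s}"
    from interlacing[OF w u mu_dec lam_dec inv pos this]
    show "mu (s + i) \<le> - 2 / lam i" "- 2 / lam i \<le> mu i" by auto
  qed
qed

end
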